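(* Let $N \ge 1$ and consider the leader-follower system on the 1D directed lattice with $N$ followers, $\dot{x}(t) = -L x(t) + d(t)$, where $L \in \mathbb{R}^{N\times N}$ is the lower triangular Toeplitz matrix with $1$ on the main diagonal, $-1$ on the first subdiagonal, and $0$ everywhere else. Let $V_n = \lim_{t\to\infty} E\{x_n^2(t)\}$ denote the steady-state variance of the $n$th follower, i.e. the $n$th diagonal entry of $P = \int_0^\infty e^{-Lt} e^{-L^T t}\,dt$. Then $$V_n = \sum_{i=1}^n \frac{(2i-2)!}{2\cdot 2^{2i-2}\,((i-1)!)^2} = \frac{n\,(2n)!}{2^{2n}\, n!\, n!}, \qquad n = 1,\ldots,N.$$ The total variance normalized by the number of followers is $$\Pi_N := \frac{1}{N}\sum_{n=1}^N V_n = \frac{(2N+1)!}{3\cdot 2^{2N}\, N!\, N!}.$$ Furthermore (with $V_n$ depending only on $n$, and not on $N \ge n$), $$\lim_{n\to\infty} \frac{V_n}{\sqrt{n}} = \sqrt{\frac{1}{\pi}}, \qquad \lim_{N\to\infty} \frac{\Pi_N}{\sqrt{N}} = \frac{2}{3\sqrt{\pi}}.$$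
   Context: The 1D leader-follower system has a leader indexed by $0$ with state $x_0(t)\equiv 0$ and followers $n=1,\dots,N$ with scalar states obeying $\dot{x}_n(t) = -(x_n(t) - x_{n-1}(t)) + d_n(t)$. In vector form with $x = [x_1 \cdots x_N]^T$ this is $\dot{x} = -Lx + d$, with $L$ as in the claim. The disturbance $d = [d_1 \cdots d_N]^T$ is zero-mean, unit-variance white noise, uncorrelated across followers (identity intensity matrix). The steady-state covariance matrix is $P := \lim_{t\to\infty} E\{x(t)x^T(t)\} = \int_0^\infty e^{-Lt} e^{-L^T t}\,dt$, where $E$ denotes expectation, and the steady-state variance $V_n$ of the $n$th follower is the $n$th diagonal entry of $P$. *)

theory Defs
  imports "HOL-Probability.Probability" "Jordan_Normal_Form.Matrix"
begin

no_notation vec_nth (infixl "$" 90)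

text \<open>
  Vectors and matrices have their dimension \<open>N\<close> as a value and are indexed from \<open>0\<close>, so follower
  \<open>n \<in> {1..N}\<close> sits at index \<open>n - 1\<close>. The leader state, identically \<open>0\<close>, is not stored: it only
  explains why the first row of \<open>L\<close> has no off-diagonal entry.
\<close>

definition lattice_matrix :: "nat \<Rightarrow> real mat" where
  "lattice_matrix N = mat N N (\<lambda>(i, j). if i = j then 1 else if i = Suc j then - 1 else 0)"

definition mat_exp :: "real mat \<Rightarrow> real mat" where
  "mat_exp A = mat (dim_row A) (dim_row A) (\<lambda>(i, j). \<Sum>k. (A ^\<^sub>m k) $$ (i, j) / fact k)"

definition steady_state_cov :: "nat \<Rightarrow> real mat" where
  "steady_state_cov N = mat N N (\<lambda>(i, j). LINT t:{0..}|lborel.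
     (mat_exp ((- t) \<cdot>\<^sub>m lattice_matrix N) * mat_exp ((- t) \<cdot>\<^sub>m (lattice_matrix N)\<^sup>T)) $$ (i, j))"

definition steady_state_var :: "nat \<Rightarrow> nat \<Rightarrow> real" where
  "steady_state_var N n = steady_state_cov N $$ (n - 1, n - 1)"

definition normalized_total_var :: "nat \<Rightarrow> real" where
  "normalized_total_var N = (1 / real N) * (\<Sum>n=1..N. steady_state_var N n)"

text \<open>
  White noise \<open>d\<close> enters through its integral \<open>W t = \<integral>\<^sub>0\<^sup>t d s ds\<close>. Integrating
  \<open>E (d s) = 0\<close> and \<open>E (d s * d\<^sup>T t) = \<delta> (s - t) * I\<close> gives the two moment conditions below. They hold
  for an \<open>N\<close>-dimensional Brownian motion; neither Gaussianity nor path continuity is required.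
\<close>

locale integrated_white_noise = prob_space M for M :: "'a measure" +
  fixes N :: nat and W :: "real \<Rightarrow> 'a \<Rightarrow> real vec"
  assumes noise_dim: "\<And>t \<omega>. t \<ge> 0 \<Longrightarrow> \<omega> \<in> space M \<Longrightarrow> W t \<omega> \<in> carrier_vec N"
    and noise_measurable: "\<And>i. i < N \<Longrightarrow>
      (\<lambda>(t, \<omega>). W t \<omega> $ i) \<in> borel_measurable (restrict_space borel {0..} \<Otimes>\<^sub>M M)"
    and noise_square_integrable: "\<And>i t. i < N \<Longrightarrow> t \<ge> 0 \<Longrightarrow> integrable M (\<lambda>\<omega>. (W t \<omega> $ i)\<^sup>2)"
    and noise_mean: "\<And>i t. i < N \<Longrightarrow> t \<ge> 0 \<Longrightarrow> expectation (\<lambda>\<omega>. W t \<omega> $ i) = 0"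
    and noise_cov: "\<And>i j s t. i < N \<Longrightarrow> j < N \<Longrightarrow> s \<ge> 0 \<Longrightarrow> t \<ge> 0 \<Longrightarrow>
      expectation (\<lambda>\<omega>. W s \<omega> $ i * W t \<omega> $ j) = (if i = j then min s t else 0)"

text \<open>
  The equation \<open>x' = - L x + d\<close> is read as
  \<open>x t = x 0 - \<integral>\<^sub>0\<^sup>t L (x s) ds + W t\<close>, path by path. The noise is additive, so no stochastic
  integral is needed. The initial state is any random vector with finite second moments.
\<close>

locale leader_follower = integrated_white_noise M N W
  for M :: "'a measure" and N :: nat and W :: "real \<Rightarrow> 'a \<Rightarrow> real vec" +
  fixes x :: "real \<Rightarrow> 'a \<Rightarrow> real vec"
  assumes state_dim: "\<And>t \<omega>. t \<ge> 0 \<Longrightarrow> \<omega> \<in> space M \<Longrightarrow> x t \<omega> \<in> carrier_vec N"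
    and state_measurable: "\<And>i t. i < N \<Longrightarrow> t \<ge> 0 \<Longrightarrow> random_variable borel (\<lambda>\<omega>. x t \<omega> $ i)"
    and initial_square_integrable: "\<And>i. i < N \<Longrightarrow> integrable M (\<lambda>\<omega>. (x 0 \<omega> $ i)\<^sup>2)"
    and dynamics: "AE \<omega> in M. \<forall>t\<ge>0. \<forall>i<N.
      set_integrable lborel {0..t} (\<lambda>s. x s \<omega> $ i) \<and>
      x t \<omega> $ i = x 0 \<omega> $ i - (LINT s:{0..t}|lborel. (lattice_matrix N *\<^sub>v x s \<omega>) $ i) + W t \<omega> $ i"

end

theory Submission
  imports Defs
begin

text \<open>
  Entry \<open>(i, j)\<close> of \<open>e\<^bsup>-L u\<^esup>\<close> is \<open>e\<^bsup>-u\<^esup> u\<^bsup>i - j\<^esup> / (i - j)!\<close> on and below the diagonal, because \<open>L\<close> is the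
  identity minus a nilpotent shift (\<open>mat_exp_lattice_matrix\<close>). Integrating the squares along a row of
  this matrix over \<open>u \<ge> 0\<close> gives the variance as a sum of gamma integrals
  (\<open>steady_state_var_sum\<close>). Each summand is half of \<open>c\<^sub>m = (2 m choose m) / 4\<^sup>m\<close>, and the recurrence
  of \<open>c\<close> gives both closed forms, \<open>V\<^sub>n = n c\<^sub>n\<close> and \<open>\<Pi>\<^sub>N = (2 N + 1) c\<^sub>N / 3\<close>, by induction. The limits
  follow from \<open>sqrt n * c\<^sub>n \<longlonglongrightarrow> 1 / sqrt pi\<close> (\<open>sqrt_central_ratio_limit\<close>), a case of the asymptotics of
  generalized binomial coefficients.

  For the convergence of the second moments to \<open>P\<close>, variation of constants, applied path by path,
  writes the state as \<open>e\<^bsup>-L t\<^esup> x(0)\<close> plus a vector of Wiener integrals of the kernels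
  (\<open>lattice_chain_solution\<close>). Their integrands are smooth and deterministic, so these integrals can
  be defined by integration by parts, without any stochastic calculus, and their covariances follow
  from Fubini's theorem and the covariance of the integrated noise (\<open>noise_integral_covariance\<close>).
  The covariance of the noise part is then the integral of \<open>e\<^bsup>-L s\<^esup> e\<^bsup>-L\<^sup>T s\<^esup>\<close> over \<open>{0..t}\<close>, which tends
  to \<open>P\<close>. The terms that contain the initial state tend to \<open>0\<close>, since the kernels decay and the noise
  part has bounded second moments (\<open>free_response_limit\<close>, \<open>free_noise_limit\<close>).
\<close>

section \<open>The exponential of the lattice matrix\<close>

text \<open>
  The entry \<open>(i, j)\<close> of \<open>e\<^bsup>-L u\<^esup>\<close>, with indices from \<open>0\<close>. It does not depend on the number of
  followers, and it is defined for all \<open>i, j\<close>, so that sums over \<open>k < N\<close> need no separate treatment of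
  the boundary index \<open>k + 1 = N\<close>.
\<close>

definition lattice_kernel :: "nat \<Rightarrow> nat \<Rightarrow> real \<Rightarrow> real" where
  "lattice_kernel i j u = (if j \<le> i then exp (- u) * u ^ (i - j) / fact (i - j) else 0)"

lemma lattice_kernel_eq_0: "i < j \<Longrightarrow> lattice_kernel i j u = 0"
  by (simp add: lattice_kernel_def)

lemma lattice_kernel_at_0: "lattice_kernel i j 0 = (if i = j then 1 else 0)"
  by (auto simp: lattice_kernel_def power_0_left)

text \<open>
  This is \<open>d/du e\<^bsup>-L u\<^esup> = - e\<^bsup>-L u\<^esup> L\<close>, written entrywise.
\<close>

lemma lattice_kernel_has_derivative:
  "((\<lambda>u. lattice_kernel i j u) has_real_derivative
      lattice_kernel i (Suc j) u - lattice_kernel i j u) (at u)"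
proof (cases "j \<le> i")
  case False
  then show ?thesis by (simp add: lattice_kernel_def)
next
  case True
  then obtain m where i: "i = j + m" using le_Suc_ex by blast
  show ?thesis
  proof (cases m)
    case 0
    then show ?thesis
      by (auto simp: lattice_kernel_def i intro!: derivative_eq_intros)
  next
    case (Suc l)
    have "((\<lambda>u. exp (- u) * u ^ Suc l / fact (Suc l)) has_real_derivative
        (exp (- u) * (real (Suc l) * u ^ l) - exp (- u) * u ^ Suc l) / fact (Suc l)) (at u)"
      by (rule DERIV_cdivide) (auto intro!: derivative_eq_intros simp: algebra_simps simp del: power_Suc)
    also have "(exp (- u) * (real (Suc l) * u ^ l) - exp (- u) * u ^ Suc l) / fact (Suc l) =
        exp (- u) * u ^ l / fact l - exp (- u) * u ^ Suc l / fact (Suc l)"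
      unfolding fact_Suc diff_divide_distrib by (simp del: power_Suc)
    finally have "((\<lambda>u. exp (- u) * u ^ Suc l / fact (Suc l)) has_real_derivative
        exp (- u) * u ^ l / fact l - exp (- u) * u ^ Suc l / fact (Suc l)) (at u)" .
    then show ?thesis by (simp add: lattice_kernel_def i Suc)
  qed
qed

lemma dim_lattice_matrix [simp]:
  "dim_row (lattice_matrix N) = N" "dim_col (lattice_matrix N) = N"
  by (simp_all add: lattice_matrix_def)

lemma lattice_matrix_carrier [simp]: "lattice_matrix N \<in> carrier_mat N N"
  by (simp add: lattice_matrix_def)

lemma lattice_matrix_mult_vec:
  assumes "v \<in> carrier_vec N" "i < N"
  shows "(lattice_matrix N *\<^sub>v v) $ i = v $ i - (if i = 0 then 0 else v $ (i - 1))"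
proof -
  have "(lattice_matrix N *\<^sub>v v) $ i =
      (\<Sum>j = 0..<N. (if i = j then v $ j else if i = Suc j then - (v $ j) else 0))"
    using assms by (auto simp: lattice_matrix_def scalar_prod_def intro!: sum.cong)
  also have "\<dots> = (\<Sum>j = 0..<N. (if j = i then v $ j else 0)) -
      (\<Sum>j = 0..<N. (if i = Suc j then v $ j else 0))"
    unfolding sum_subtractf [symmetric] by (intro sum.cong) auto
  also have "(\<Sum>j = 0..<N. (if j = i then v $ j else 0)) = v $ i"
    using assms by simp
  also have "(\<Sum>j = 0..<N. (if i = Suc j then v $ j else 0)) = (if i = 0 then 0 else v $ (i - 1))"
    using assms by (cases i) auto
  finally show ?thesis .
qed

text \<open>
  \<open>L = I - S\<close> for the nilpotent shift \<open>S\<close>, so its powers are given by the binomial theorem.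
\<close>

lemma pow_lattice_matrix:
  assumes "i < N" "j < N"
  shows "(lattice_matrix N ^\<^sub>m k) $$ (i, j) =
    (if j \<le> i then (- 1) ^ (i - j) * real (k choose (i - j)) else 0)"
  using assms
proof (induction k arbitrary: i j)
  case 0
  then show ?case by auto
next
  case (Suc k)
  let ?P = "lattice_matrix N ^\<^sub>m k"
  have "(lattice_matrix N ^\<^sub>m Suc k) $$ (i, j) =
      (\<Sum>l = 0..<N. ?P $$ (i, l) * lattice_matrix N $$ (l, j))"
    using Suc.prems by (simp add: scalar_prod_def)
  also have "\<dots> = (\<Sum>l = 0..<N. (if l = j then ?P $$ (i, l) else 0)) -
      (\<Sum>l = 0..<N. (if l = Suc j then ?P $$ (i, l) else 0))"
    unfolding sum_subtractf [symmetric]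
    using Suc.prems by (intro sum.cong) (auto simp: lattice_matrix_def)
  also have "\<dots> = ?P $$ (i, j) - (if Suc j < N then ?P $$ (i, Suc j) else 0)"
    using Suc.prems by simp
  also have "\<dots> = (if j \<le> i then (- 1) ^ (i - j) * real (Suc k choose (i - j)) else 0)"
  proof (cases "Suc j \<le> i")
    case True
    then obtain m where m: "i = Suc j + m" using le_Suc_ex by blast
    show ?thesis using Suc.prems by (simp add: Suc.IH m algebra_simps)
  next
    case False
    then show ?thesis using Suc.prems by (cases "i = j") (auto simp: Suc.IH)
  qed
  finally show ?case .
qed

text \<open>
  The exponential series of an entry of \<open>- t L\<close> on the \<open>m\<close>-th subdiagonal. Its first \<open>m\<close> terms vanish,
  and the rest is the exponential series of \<open>- t\<close>, multiplied by \<open>t\<^sup>m / m!\<close>.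
\<close>

lemma sums_choose_exp:
  fixes t :: real
  shows "(\<lambda>k. (- t) ^ k * ((- 1) ^ m * real (k choose m)) / fact k) sums
    (exp (- t) * t ^ m / fact m)"
proof -
  let ?f = "\<lambda>k. (- t) ^ k * ((- 1) ^ m * real (k choose m)) / fact k"
  have "(\<lambda>k. (t ^ m / fact m) * ((- t) ^ k /\<^sub>R fact k)) sums ((t ^ m / fact m) * exp (- t))"
    by (intro sums_mult exp_converges)
  moreover have "(t ^ m / fact m) * ((- t) ^ k /\<^sub>R fact k) = ?f (k + m)" for k
  proof -
    have *: "real (k + m choose m) = fact (k + m) / (fact m * fact k)"
      by (subst binomial_fact) auto
    have "(- t) ^ (k + m) * (- 1) ^ m = (- t) ^ k * t ^ m"
      by (simp add: power_add power_mult_distrib [symmetric])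
    then have "?f (k + m) = ((- t) ^ k * t ^ m) * (real (k + m choose m) / fact (k + m))"
      by (simp add: mult.assoc [symmetric])
    also have "real (k + m choose m) / fact (k + m) = 1 / (fact m * fact k)"
      unfolding * by simp
    finally show ?thesis by (simp add: field_simps)
  qed
  ultimately have "(\<lambda>k. ?f (k + m)) sums ((t ^ m / fact m) * exp (- t))" by simp
  then have "?f sums (((t ^ m / fact m) * exp (- t)) + (\<Sum>k<m. ?f k))"
    by (subst (asm) sums_iff_shift) simp
  moreover have "(\<Sum>k<m. ?f k) = 0" by (intro sum.neutral) auto
  ultimately show ?thesis by (simp add: mult.commute)
qed

lemma pow_smult_mat:
  assumes "(A :: real mat) \<in> carrier_mat n n"
  shows "(c \<cdot>\<^sub>m A) ^\<^sub>m k = c ^ k \<cdot>\<^sub>m (A ^\<^sub>m k)"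
  using assms
proof (induction k)
  case (Suc k)
  have P: "A ^\<^sub>m k \<in> carrier_mat n n" using Suc.prems by simp
  have "(c \<cdot>\<^sub>m A) ^\<^sub>m Suc k = (c ^ k \<cdot>\<^sub>m (A ^\<^sub>m k)) * (c \<cdot>\<^sub>m A)"
    using Suc by simp
  also have "\<dots> = c ^ Suc k \<cdot>\<^sub>m (A ^\<^sub>m Suc k)"
    using Suc.prems P by (intro eq_matI) (auto simp: field_simps)
  finally show ?case .
qed auto

lemma pow_mat_Suc_left:
  assumes "(A :: real mat) \<in> carrier_mat n n"
  shows "A ^\<^sub>m Suc k = A * A ^\<^sub>m k"
proof (induction k)
  case (Suc k)
  have "A ^\<^sub>m Suc (Suc k) = (A * A ^\<^sub>m k) * A" using Suc by simp
  also have "\<dots> = A * (A ^\<^sub>m k * A)"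
    using assms by (intro assoc_mult_mat [of _ n n _ n _ n]) auto
  finally show ?case by simp
qed (use assms in auto)

lemma pow_transpose_mat:
  assumes "(A :: real mat) \<in> carrier_mat n n"
  shows "(A\<^sup>T) ^\<^sub>m k = (A ^\<^sub>m k)\<^sup>T"
  using assms
proof (induction k)
  case (Suc k)
  have "(A\<^sup>T) ^\<^sub>m Suc k = (A ^\<^sub>m k)\<^sup>T * A\<^sup>T" using Suc by simp
  also have "\<dots> = (A * A ^\<^sub>m k)\<^sup>T"
    using Suc.prems by (subst transpose_mult) auto
  also have "A * A ^\<^sub>m k = A ^\<^sub>m Suc k"
    using pow_mat_Suc_left [OF Suc.prems] by simp
  finally show ?case .
qed auto

lemma mat_exp_lattice_matrix:
  assumes "i < N" "j < N"
  shows "mat_exp (t \<cdot>\<^sub>m lattice_matrix N) $$ (i, j) = lattice_kernel i j (- t)"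
    and "mat_exp (t \<cdot>\<^sub>m (lattice_matrix N)\<^sup>T) $$ (i, j) = lattice_kernel j i (- t)"
proof -
  have *: "(\<Sum>k. (t ^ k * (if j \<le> i then (- 1) ^ (i - j) * real (k choose (i - j)) else 0)) / fact k)
    = lattice_kernel i j (- t)" for i j
    using sums_choose_exp [of "- t" "i - j"]
    by (auto simp: lattice_kernel_def sums_iff)
  show "mat_exp (t \<cdot>\<^sub>m lattice_matrix N) $$ (i, j) = lattice_kernel i j (- t)"
    using assms by (simp add: mat_exp_def pow_smult_mat [of _ N] pow_lattice_matrix * cong: if_cong)
  show "mat_exp (t \<cdot>\<^sub>m (lattice_matrix N)\<^sup>T) $$ (i, j) = lattice_kernel j i (- t)"
    using assms
    by (simp add: mat_exp_def pow_smult_mat [of _ N] pow_transpose_mat [of _ N] pow_lattice_matrix * cong: if_cong)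
qed

lemma mat_exp_mult_transpose:
  assumes "i < N" "j < N"
  shows "(mat_exp ((- t) \<cdot>\<^sub>m lattice_matrix N) * mat_exp ((- t) \<cdot>\<^sub>m (lattice_matrix N)\<^sup>T)) $$ (i, j) =
    (\<Sum>k<N. lattice_kernel i k t * lattice_kernel j k t)"
proof -
  have "dim_row (mat_exp A) = dim_row A" "dim_col (mat_exp A) = dim_row A" for A
    by (simp_all add: mat_exp_def)
  then have "(mat_exp ((- t) \<cdot>\<^sub>m lattice_matrix N) * mat_exp ((- t) \<cdot>\<^sub>m (lattice_matrix N)\<^sup>T)) $$ (i, j) =
    (\<Sum>k = 0..<N. mat_exp ((- t) \<cdot>\<^sub>m lattice_matrix N) $$ (i, k) *
       mat_exp ((- t) \<cdot>\<^sub>m (lattice_matrix N)\<^sup>T) $$ (k, j))"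
    using assms by (simp add: scalar_prod_def)
  also have "\<dots> = (\<Sum>k<N. lattice_kernel i k t * lattice_kernel j k t)"
    using assms by (intro sum.cong) (auto simp: mat_exp_lattice_matrix)
  finally show ?thesis .
qed

lemma steady_state_cov_eq:
  assumes "i < N" "j < N"
  shows "steady_state_cov N $$ (i, j) =
    (LINT t:{0..}|lborel. (\<Sum>k<N. lattice_kernel i k t * lattice_kernel j k t))"
  using assms by (simp only: steady_state_cov_def index_mat mat_exp_mult_transpose prod.case)

section \<open>Steady-state variances and their asymptotics\<close>

text \<open>
  This restates that the Erlang density of rate \<open>2\<close> has total mass \<open>1\<close>.
\<close>

lemma has_bochner_integral_power_exp:
  "has_bochner_integral lborel (\<lambda>u. indicator {0..} u * (u ^ n * exp (- 2 * u)))
     (fact n / 2 ^ Suc n :: real)"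
proof -
  have "(\<integral>\<^sup>+ u. ennreal (erlang_density n 2 u) \<partial>lborel) = ennreal 1"
    using nn_integral_erlang_ith_moment [of 2 n 0] by simp
  then have "has_bochner_integral lborel (erlang_density n 2) 1"
    by (intro has_bochner_integral_nn_integral) auto
  then have "has_bochner_integral lborel (\<lambda>u. (fact n / 2 ^ Suc n) * erlang_density n 2 u)
      (fact n / 2 ^ Suc n * 1)"
    by (rule has_bochner_integral_mult_right)
  moreover have "(fact n / 2 ^ Suc n) * erlang_density n 2 u =
      indicator {0..} u * (u ^ n * exp (- 2 * u))" for u :: real
    by (simp add: erlang_density_def indicator_def)
  ultimately show ?thesis by simp
qed

lemma kernel_product_integrable:
  "set_integrable lborel {0..} (\<lambda>u. lattice_kernel i k u * lattice_kernel j k u)"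
proof (cases "k \<le> i \<and> k \<le> j")
  case True
  define a b where "a = i - k" and "b = j - k"
  have "exp (- 2 * u) = exp (- u) * exp (- u)" for u :: real
    by (simp flip: exp_add)
  then have "lattice_kernel i k u * lattice_kernel j k u =
     (1 / (fact a * fact b)) * (u ^ (a + b) * exp (- 2 * u))" for u
    using True by (simp add: lattice_kernel_def power_add a_def [symmetric] b_def [symmetric] mult_ac)
  moreover have "set_integrable lborel {0..} (\<lambda>u::real. u ^ (a + b) * exp (- 2 * u))"
    using has_bochner_integral_power_exp [of "a + b"]
    by (simp add: set_integrable_def has_bochner_integral_iff)
  ultimately show ?thesis by simp
next
  case False
  then show ?thesis by (auto simp: lattice_kernel_def set_integrable_def)
qed

lemma kernel_square_integral:
  "(LINT u:{0..}|lborel. lattice_kernel (k + m) k u * lattice_kernel (k + m) k u) =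
    fact (2 * m) / (2 * 2 ^ (2 * m) * (fact m)\<^sup>2)"
proof -
  have eq: "lattice_kernel (k + m) k u * lattice_kernel (k + m) k u =
     (1 / (fact m)\<^sup>2) * (u ^ (2 * m) * exp (- 2 * u))" for u
  proof -
    have "exp (- 2 * u) = exp (- u) * exp (- u)" by (simp flip: exp_add)
    moreover have "u ^ (2 * m) = u ^ m * u ^ m" by (simp only: mult_2 power_add)
    ultimately show ?thesis by (simp add: lattice_kernel_def power2_eq_square mult_ac)
  qed
  have "(LINT u:{0..}|lborel. u ^ (2 * m) * exp (- 2 * u)) = fact (2 * m) / (2 :: real) ^ Suc (2 * m)"
    using has_bochner_integral_power_exp [of "2 * m"]
    by (simp add: set_lebesgue_integral_def has_bochner_integral_iff)
  then show ?thesis unfolding eq by simp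
qed

lemma steady_state_cov_sum:
  assumes "i < N" "j < N"
  shows "steady_state_cov N $$ (i, j) =
    (\<Sum>k<N. LINT t:{0..}|lborel. lattice_kernel i k t * lattice_kernel j k t)"
  unfolding steady_state_cov_eq [OF assms]
  unfolding set_lebesgue_integral_def scaleR_sum_right
  by (rule Bochner_Integration.integral_sum)
    (use kernel_product_integrable in \<open>simp add: set_integrable_def\<close>)

text \<open>
  The integral over \<open>u \<ge> 0\<close> of the square of a kernel on the \<open>m\<close>-th subdiagonal, that is, the
  contribution to the variance of a follower of the disturbance acting \<open>m\<close> places ahead of it.
\<close>

definition kernel_energy :: "nat \<Rightarrow> real" where
  "kernel_energy m = fact (2 * m) / (2 * 2 ^ (2 * m) * (fact m)\<^sup>2)"

lemma steady_state_var_sum: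
  assumes n: "1 \<le> n" "n \<le> N"
  shows "steady_state_var N n = (\<Sum>m<n. kernel_energy m)"
proof -
  let ?V = "\<lambda>k. LINT t:{0..}|lborel. lattice_kernel (n - 1) k t * lattice_kernel (n - 1) k t"
  have "steady_state_var N n = (\<Sum>k<N. ?V k)"
    unfolding steady_state_var_def using n by (intro steady_state_cov_sum) auto
  also have "\<dots> = (\<Sum>k<n. ?V k)"
    using n by (intro sum.mono_neutral_right) (auto simp: lattice_kernel_eq_0)
  also have "\<dots> = (\<Sum>m<n. kernel_energy m)"
  \<comment> \<open>Follower \<open>n\<close> has index \<open>n - 1\<close>, so the disturbance with index \<open>k\<close> is \<open>n - 1 - k\<close> places ahead.\<close>
  proof (rule sum.reindex_bij_witness [where i = "\<lambda>m. n - 1 - m" and j = "\<lambda>k. n - 1 - k"])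
    fix k assume k: "k \<in> {..<n}"
    then have "n - 1 = k + (n - 1 - k)" by auto
    then show "kernel_energy (n - 1 - k) = ?V k"
      using kernel_square_integral [of k "n - 1 - k"] by (simp add: kernel_energy_def)
  qed (use n in auto)
  finally show ?thesis .
qed

text \<open>
  The normalized central binomial coefficient, \<open>(2 n choose n) / 4\<^sup>n\<close>.
\<close>

definition central_ratio :: "nat \<Rightarrow> real" where
  "central_ratio n = fact (2 * n) / (2 ^ (2 * n) * (fact n)\<^sup>2)"

lemma central_ratio_0 [simp]: "central_ratio 0 = 1"
  by (simp add: central_ratio_def)

lemma central_ratio_Suc:
  "central_ratio (Suc n) = central_ratio n * (2 * real n + 1) / (2 * real n + 2)"
proof -
  define c where "c = 2 * real n + 2"
  have c: "c \<noteq> 0" unfolding c_def by linarith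
  have num: "fact (2 * Suc n) = c * ((2 * real n + 1) * fact (2 * n))"
    by (simp add: c_def algebra_simps)
  have fact: "fact (Suc n) = c / 2 * (fact n :: real)" by (simp add: c_def algebra_simps)
  have "central_ratio (Suc n) =
      (c * ((2 * real n + 1) * fact (2 * n))) / (c * (c * (2 ^ (2 * n) * (fact n)\<^sup>2)))"
    unfolding central_ratio_def num fact by (simp add: power2_eq_square mult_ac)
  also have "\<dots> = central_ratio n * (2 * real n + 1) / c"
    using c by (simp add: central_ratio_def mult_ac)
  finally show ?thesis by (simp only: c_def)
qed

lemma sum_kernel_energy: "(\<Sum>m<n. kernel_energy m) = real n * central_ratio n"
proof (induction n)
  case (Suc n)
  have "kernel_energy n = central_ratio n / 2"
    by (simp only: kernel_energy_def central_ratio_def divide_divide_eq_left mult_ac)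
  then have "(\<Sum>m<Suc n. kernel_energy m) = central_ratio n * (2 * real n + 1) / 2"
    using Suc by (simp add: algebra_simps)
  also have "\<dots> = real (Suc n) * central_ratio (Suc n)"
    unfolding central_ratio_Suc by (simp add: divide_simps) (simp add: algebra_simps)
  finally show ?case .
qed simp

lemma steady_state_var_eq: "1 \<le> n \<Longrightarrow> n \<le> N \<Longrightarrow> steady_state_var N n = real n * central_ratio n"
  by (simp add: steady_state_var_sum sum_kernel_energy)

lemma sum_mult_central_ratio:
  "(\<Sum>n=1..N. real n * central_ratio n) = real N * (2 * real N + 1) / 3 * central_ratio N"
proof (induction N)
  case (Suc N)
  have nz: "2 * real N + 2 \<noteq> 0" by linarith
  then have "central_ratio N * (2 * real N + 1) = central_ratio (Suc N) * (2 * real N + 2)"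
    by (simp add: central_ratio_Suc)
  then have "real N * (2 * real N + 1) / 3 * central_ratio N =
      real N * (2 * real N + 2) / 3 * central_ratio (Suc N)"
    by (simp add: mult_ac)
  then show ?case using Suc by (simp add: algebra_simps)
qed simp

lemma normalized_total_var_eq:
  assumes "1 \<le> N"
  shows "normalized_total_var N = (2 * real N + 1) / 3 * central_ratio N"
proof -
  have "(\<Sum>n=1..N. steady_state_var N n) = (\<Sum>n=1..N. real n * central_ratio n)"
    by (intro sum.cong) (auto simp: steady_state_var_eq)
  then show ?thesis
    unfolding normalized_total_var_def sum_mult_central_ratio using assms by simp
qed

text \<open>
  The generalized binomial coefficient of \<open>- 1 / 2\<close> has asymptotics \<open>1 / (\<Gamma>(1 / 2) * sqrt n)\<close> up to
  sign, and \<open>\<Gamma>(1 / 2) = sqrt pi\<close>. This identity transfers them to the central binomial coefficient.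
\<close>

lemma central_ratio_gbinomial: "central_ratio n = (- 1) ^ n * ((- 1 / 2) gchoose n)"
proof (induction n)
  case (Suc n)
  have "a gchoose Suc n = (a gchoose n) * (a - real n) / (real n + 1)" for a :: real
    by (simp add: gbinomial_prod_rev mult.commute)
  then have "(- 1 / 2 :: real) gchoose Suc n = ((- 1 / 2) gchoose n) * (- 1 / 2 - real n) / (real n + 1)" .
  moreover have "- 1 / 2 - real n = - (1 / 2 + real n)" by simp
  ultimately have rec: "(- 1 / 2 :: real) gchoose Suc n = - (((- 1 / 2) gchoose n) * ((1 / 2 + real n) / (real n + 1)))"
    by (simp only: mult_minus_right minus_divide_left [symmetric] times_divide_eq_right)
  have "(1 / 2 + real n) / (real n + 1) = (2 * real n + 1) / (2 * real n + 2)"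
    by (simp add: divide_simps)
  then have "central_ratio (Suc n) = central_ratio n * ((1 / 2 + real n) / (real n + 1))"
    by (simp add: central_ratio_Suc)
  then show ?case unfolding rec Suc.IH by simp
qed simp

lemma sqrt_central_ratio_limit: "(\<lambda>n. sqrt (real n) * central_ratio n) \<longlonglongrightarrow> 1 / sqrt pi"
proof -
  have "(\<lambda>n. ((- 1 / 2 :: real) gchoose n) / ((- 1) ^ n / exp ((- 1 / 2 + 1) * of_real (ln (real n)))))
      \<longlonglongrightarrow> inverse (Gamma (- (- 1 / 2)))"
    by (rule gbinomial_asymptotic)
  moreover have "eventually (\<lambda>n. ((- 1 / 2 :: real) gchoose n) /
      ((- 1) ^ n / exp ((- 1 / 2 + 1) * of_real (ln (real n)))) = sqrt (real n) * central_ratio n) sequentially"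
    using eventually_gt_at_top [of 0]
  proof eventually_elim
    case (elim n)
    have *: "exp ((- 1 / 2 + 1) * ln (real n)) = sqrt (real n)"
      using elim by (simp add: powr_half_sqrt [symmetric] powr_def)
    have "a / ((- 1) ^ n / b) = b * ((- 1) ^ n * a)" for a b :: real
      by (cases "even n") auto
    then show ?case by (simp only: of_real_eq_id id_apply * central_ratio_gbinomial)
  qed
  ultimately have "(\<lambda>n. sqrt (real n) * central_ratio n) \<longlonglongrightarrow> inverse (Gamma (1 / 2))"
    by (simp add: tendsto_cong)
  then show ?thesis by (simp add: Gamma_one_half_real inverse_eq_divide)
qed

lemma steady_state_var_asymptotics:
  "(\<lambda>n. steady_state_var n n / sqrt (real n)) \<longlonglongrightarrow> sqrt (1 / pi)"
proof -
  have "eventually (\<lambda>n. sqrt (real n) * central_ratio n = steady_state_var n n / sqrt (real n)) sequentially"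
    using eventually_ge_at_top [of 1]
  proof eventually_elim
    case (elim n)
    have "real n * central_ratio n / sqrt (real n) = (real n / sqrt (real n)) * central_ratio n"
      by simp
    then show ?case using elim by (simp only: steady_state_var_eq order_refl real_div_sqrt of_nat_0_le_iff)
  qed
  from Lim_transform_eventually [OF sqrt_central_ratio_limit this]
  show ?thesis by (simp add: real_sqrt_divide)
qed

lemma normalized_total_var_asymptotics:
  "(\<lambda>N. normalized_total_var N / sqrt (real N)) \<longlonglongrightarrow> 2 / (3 * sqrt pi)"
proof -
  have "(\<lambda>N. (2 + 1 / real N) / 3 * (sqrt (real N) * central_ratio N)) \<longlonglongrightarrow>
      (2 + 0) / 3 * (1 / sqrt pi)"
    by (intro tendsto_intros sqrt_central_ratio_limit lim_1_over_n) simp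
  moreover have "eventually (\<lambda>N. (2 + 1 / real N) / 3 * (sqrt (real N) * central_ratio N) =
      normalized_total_var N / sqrt (real N)) sequentially"
    using eventually_ge_at_top [of 1]
  proof eventually_elim
    case (elim N)
    have "(2 + 1 / real N) * sqrt (real N) = (2 * real N + 1) / sqrt (real N)"
      using elim by (simp add: field_simps)
    then have "(2 + 1 / real N) / 3 * (sqrt (real N) * central_ratio N) =
       ((2 * real N + 1) / sqrt (real N)) / 3 * central_ratio N" by (simp add: mult_ac)
    then show ?case using elim by (simp add: normalized_total_var_eq)
  qed
  ultimately show ?thesis
    by (simp add: Lim_transform_eventually)
qed

lemma steady_state_var_closed_forms:
  assumes "1 \<le> n" "n \<le> N"
  shows "steady_state_var N n = (\<Sum>i=1..n. fact (2 * i - 2) / (2 * 2 ^ (2 * i - 2) * (fact (i - 1))\<^sup>2))"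
    and "steady_state_var N n = real n * fact (2 * n) / (2 ^ (2 * n) * fact n * fact n)"
proof -
  have "(\<Sum>i=1..n. fact (2 * i - 2) / (2 * 2 ^ (2 * i - 2) * (fact (i - 1))\<^sup>2)) = (\<Sum>m<n. kernel_energy m)"
  proof (rule sum.reindex_bij_witness [where i = Suc and j = "\<lambda>i. i - 1"])
    fix i assume "i \<in> {1..n}"
    then have "2 * (i - 1) = 2 * i - 2" by simp
    then show "kernel_energy (i - 1) = fact (2 * i - 2) / (2 * 2 ^ (2 * i - 2) * (fact (i - 1))\<^sup>2)"
      by (simp only: kernel_energy_def)
  qed auto
  then show "steady_state_var N n = (\<Sum>i=1..n. fact (2 * i - 2) / (2 * 2 ^ (2 * i - 2) * (fact (i - 1))\<^sup>2))"
    using assms by (simp add: steady_state_var_sum)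
  show "steady_state_var N n = real n * fact (2 * n) / (2 ^ (2 * n) * fact n * fact n)"
    unfolding steady_state_var_eq [OF assms] central_ratio_def power2_eq_square
    by (simp only: times_divide_eq_right mult.assoc)
qed

lemma normalized_total_var_closed_form:
  assumes "1 \<le> N"
  shows "normalized_total_var N = fact (2 * N + 1) / (3 * 2 ^ (2 * N) * fact N * fact N)"
proof -
  have "(fact (2 * N + 1) :: real) = (2 * real N + 1) * fact (2 * N)" by simp
  then show ?thesis
    unfolding normalized_total_var_eq [OF assms] central_ratio_def power2_eq_square
    by (simp only: times_divide_times_eq mult.assoc)
qed

section \<open>Integration by parts for integrable functions\<close>

lemma continuous_on_primitive:
  fixes f :: "real \<Rightarrow> real"
  assumes f: "set_integrable lborel {0..t} f"
  shows "continuous_on {0..t} (\<lambda>s. LINT r:{0..s}|lborel. f r)"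
proof -
  have "continuous_on {0..t} (\<lambda>s. integral {0..s} f)"
    by (intro indefinite_integral_continuous_1 set_borel_integral_eq_integral(1) f)
  moreover have "integral {0..s} f = (LINT r:{0..s}|lborel. f r)" if "s \<in> {0..t}" for s
    using that by (intro set_borel_integral_eq_integral(2) [symmetric] set_integrable_subset [OF f]) auto
  ultimately show ?thesis by (rule continuous_on_eq)
qed

lemma set_integrable_continuous_mult:
  fixes f \<phi> :: "real \<Rightarrow> real"
  assumes f: "set_integrable lborel {0..t} f" and \<phi>: "continuous_on UNIV \<phi>"
  shows "set_integrable lborel {0..t} (\<lambda>s. \<phi> s * f s)"
proof -
  obtain B where B: "\<And>s. s \<in> {0..t} \<Longrightarrow> \<bar>\<phi> s\<bar> \<le> B"
    using compact_imp_bounded [OF compact_continuous_image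
        [OF continuous_on_subset [OF \<phi> subset_UNIV] compact_Icc [of 0 t]]]
    by (force simp: bounded_iff)
  have [measurable]: "\<phi> \<in> borel_measurable borel"
    using \<phi> by (rule borel_measurable_continuous_onI)
  have g: "integrable lborel (\<lambda>s. indicator {0..t} s * f s)"
    using f by (simp add: set_integrable_def)
  note [measurable] = borel_measurable_integrable [OF g]
  from g have "integrable lborel (\<lambda>s. B * (indicator {0..t} s * f s))" by simp
  then have "integrable lborel (\<lambda>s. \<phi> s * (indicator {0..t} s * f s))"
  proof (rule Bochner_Integration.integrable_bound)
    show "AE s in lborel. norm (\<phi> s * (indicator {0..t} s * f s)) \<le>
        norm (B * (indicator {0..t} s * f s))"
      using B by (intro AE_I2) (force simp: abs_mult indicator_def intro!: mult_right_mono)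
  qed simp
  then show ?thesis by (simp add: set_integrable_def mult_ac)
qed

text \<open>
  Integration by parts in which one factor is the primitive of a function that is only integrable.
  Sample paths of the state and of the noise need not be continuous, so the versions for
  differentiable functions do not apply. The identity is Fubini's theorem for
  \<open>\<phi>' r * f s\<close> on the triangle \<open>0 \<le> s \<le> r \<le> t\<close>.
\<close>

lemma integral_by_parts_primitive:
  fixes f \<phi> \<phi>' :: "real \<Rightarrow> real"
  assumes t: "0 \<le> t"
    and f: "set_integrable lborel {0..t} f"
    and deriv: "\<And>s. (\<phi> has_real_derivative \<phi>' s) (at s)"
    and cont: "continuous_on UNIV \<phi>'"
  shows "(LINT s:{0..t}|lborel. \<phi> s * f s) =
    \<phi> t * (LINT s:{0..t}|lborel. f s) - (LINT r:{0..t}|lborel. \<phi>' r * (LINT s:{0..r}|lborel. f s))"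
proof -
  define g where "g s = indicator {0..t} s * f s" for s
  define h where "h r = indicator {0..t} r * \<phi>' r" for r
  have g: "integrable lborel g" using f by (simp add: g_def [abs_def] set_integrable_def)
  have h: "integrable lborel h"
    using borel_integrable_atLeastAtMost' [of 0 t \<phi>'] continuous_on_subset [OF cont]
    by (simp add: h_def [abs_def] set_integrable_def)
  have [measurable]: "g \<in> borel_measurable borel" "h \<in> borel_measurable borel"
    using g h by (auto dest!: borel_measurable_integrable)
  have gh: "integrable (lborel \<Otimes>\<^sub>M lborel) (\<lambda>(s, r). g s * h r)"
    using g h by (intro lborel_pair.Fubini_integrable) (auto simp: abs_mult)
  have gh': "integrable (lborel \<Otimes>\<^sub>M lborel) (\<lambda>(s, r). if s \<le> r then g s * h r else 0)"
    by (rule Bochner_Integration.integrable_bound [OF gh]) (auto simp: split_beta')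
  have cont\<phi>: "continuous_on A \<phi>" for A
    using deriv by (meson DERIV_isCont continuous_at_imp_continuous_on)
  have \<phi>f: "set_integrable lborel {0..t} (\<lambda>s. \<phi> s * f s)"
    by (rule set_integrable_continuous_mult [OF f cont\<phi>])
  have "\<phi> t * (LINT s:{0..t}|lborel. f s) - (LINT s:{0..t}|lborel. \<phi> s * f s) =
      (LINT s:{0..t}|lborel. f s * (\<phi> t - \<phi> s))"
    using f \<phi>f by (simp add: algebra_simps flip: set_integral_mult_right)
  also have "\<dots> = (\<integral>s. (\<integral>r. (if s \<le> r then g s * h r else 0) \<partial>lborel) \<partial>lborel)"
    unfolding set_lebesgue_integral_def
  proof (rule Bochner_Integration.integral_cong [OF refl])
    fix s :: real
    show "indicator {0..t} s *\<^sub>R (f s * (\<phi> t - \<phi> s)) = (\<integral>r. (if s \<le> r then g s * h r else 0) \<partial>lborel)"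
    proof (cases "s \<in> {0..t}")
      case True
      have "(\<integral>r. indicator {s..t} r *\<^sub>R \<phi>' r \<partial>lborel) = \<phi> t - \<phi> s"
        using True continuous_on_subset [OF cont]
        by (intro integral_FTC_atLeastAtMost)
          (auto simp flip: has_real_derivative_iff_has_vector_derivative
            intro!: has_field_derivative_at_within deriv)
      moreover have "(if s \<le> r then g s * h r else 0) = f s * (indicator {s..t} r *\<^sub>R \<phi>' r)" for r
        using True by (auto simp: g_def h_def indicator_def)
      ultimately show ?thesis using True by simp
    next
      case False
      then have "g s = 0" by (simp add: g_def)
      then show ?thesis using False by (simp cong: if_cong)
    qed
  qed
  also have "\<dots> = (\<integral>r. (\<integral>s. (if s \<le> r then g s * h r else 0) \<partial>lborel) \<partial>lborel)"
    by (rule lborel_pair.Fubini_integral [symmetric, OF gh'])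
  also have "\<dots> = (LINT r:{0..t}|lborel. \<phi>' r * (LINT s:{0..r}|lborel. f s))"
    unfolding set_lebesgue_integral_def
  proof (rule Bochner_Integration.integral_cong [OF refl])
    fix r :: real
    have *: "(if s \<le> r then g s * h r else 0) =
        (indicator {0..t} r * \<phi>' r) * (indicator {0..r} s *\<^sub>R f s)" for s
      by (auto simp: g_def h_def indicator_def)
    show "(\<integral>s. (if s \<le> r then g s * h r else 0) \<partial>lborel) =
        indicator {0..t} r *\<^sub>R (\<phi>' r * (\<integral>s. indicator {0..r} s *\<^sub>R f s \<partial>lborel))"
      unfolding * by simp
  qed
  finally show ?thesis by simp
qed

lemma set_integral_const_Icc: "0 \<le> s \<Longrightarrow> (LINT r:{0..s}|lborel. (1::real)) = s"
  by (simp add: set_lebesgue_integral_def)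

text \<open>
  The calculus behind the isometry of the noise integral. The left-hand side is what remains of the
  covariance of two noise integrals after the covariance \<open>min s r\<close> of the noise has been inserted.
\<close>

lemma covariance_identity:
  fixes f f' g g' :: "real \<Rightarrow> real"
  assumes t: "0 \<le> t"
    and f: "\<And>s. (f has_real_derivative f' s) (at s)" "continuous_on UNIV f'"
    and g: "\<And>s. (g has_real_derivative g' s) (at s)" "continuous_on UNIV g'"
  shows "f t * g t * t - f t * (LINT r:{0..t}|lborel. g' r * r) - g t * (LINT s:{0..t}|lborel. f' s * s)
     + (LINT s:{0..t}|lborel. f' s * (LINT r:{0..t}|lborel. g' r * min s r)) =
    (LINT s:{0..t}|lborel. f s * g s)"
proof -
  have cont: "continuous_on A f" "continuous_on A g" for A
    using f g by (meson DERIV_isCont continuous_at_imp_continuous_on)+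
  have int_g: "set_integrable lborel {0..s} g" for s
    by (rule borel_integrable_atLeastAtMost' [OF cont(2)])
  have lin: "(LINT s:{0..t}|lborel. \<phi>' s * s) = \<phi> t * t - (LINT s:{0..t}|lborel. \<phi> s)"
    if "\<And>s. (\<phi> has_real_derivative \<phi>' s) (at s)" "continuous_on UNIV \<phi>'" for \<phi> \<phi>'
  proof -
    have "(LINT s:{0..t}|lborel. \<phi> s * 1) = \<phi> t * (LINT s:{0..t}|lborel. 1) -
       (LINT r:{0..t}|lborel. \<phi>' r * (LINT s:{0..r}|lborel. 1))"
      using t that by (intro integral_by_parts_primitive borel_integrable_atLeastAtMost') auto
    also have "(LINT r:{0..t}|lborel. \<phi>' r * (LINT s:{0..r}|lborel. 1)) = (LINT s:{0..t}|lborel. \<phi>' s * s)"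
      by (intro set_lebesgue_integral_cong) (auto simp: set_integral_const_Icc)
    finally show ?thesis using t by (simp add: set_integral_const_Icc)
  qed
  have inner: "(LINT r:{0..t}|lborel. g' r * min s r) = g t * s - (LINT r:{0..s}|lborel. g r)"
    if s: "s \<in> {0..t}" for s
  proof -
    \<comment> \<open>As a function of \<open>r\<close>, \<open>min s r\<close> is the primitive of the indicator of \<open>{0..s}\<close>.\<close>
    let ?k = "\<lambda>v. indicator {0..s} v :: real"
    have k: "(LINT v:{0..r}|lborel. ?k v) = min s r" if "0 \<le> r" for r
    proof -
      have "(LINT v:{0..r}|lborel. ?k v) = (LINT v:{0..min s r}|lborel. 1)"
        unfolding set_lebesgue_integral_def
        by (intro Bochner_Integration.integral_cong) (auto simp: indicator_def)
      then show ?thesis using s that by (simp add: set_integral_const_Icc)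
    qed
    have int_k: "set_integrable lborel {0..t} ?k"
      unfolding set_integrable_def real_scaleR_def
      by (intro integrable_real_mult_indicator integrable_real_indicator)
        (simp_all add: emeasure_lborel_Icc_eq)
    have "(LINT v:{0..t}|lborel. g v * ?k v) = g t * (LINT v:{0..t}|lborel. ?k v) -
       (LINT r:{0..t}|lborel. g' r * (LINT v:{0..r}|lborel. ?k v))"
      using t g int_k by (intro integral_by_parts_primitive) auto
    also have "(LINT r:{0..t}|lborel. g' r * (LINT v:{0..r}|lborel. ?k v)) =
        (LINT r:{0..t}|lborel. g' r * min s r)"
      by (intro set_lebesgue_integral_cong) (auto simp: k)
    also have "(LINT v:{0..t}|lborel. ?k v) = s" using s k [of t] by simp
    also have "(LINT v:{0..t}|lborel. g v * ?k v) = (LINT v:{0..s}|lborel. g v)"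
      unfolding set_lebesgue_integral_def using s
      by (intro Bochner_Integration.integral_cong) (auto simp: indicator_def)
    finally show ?thesis by simp
  qed
  have int1: "set_integrable lborel {0..t} (\<lambda>s. f' s * s)"
    by (intro borel_integrable_atLeastAtMost' continuous_intros continuous_on_subset [OF f(2)]) auto
  have "continuous_on {0..t} (\<lambda>s. LINT r:{0..s}|lborel. g r)"
    by (rule continuous_on_primitive [OF int_g])
  then have int2: "set_integrable lborel {0..t} (\<lambda>s. f' s * (LINT r:{0..s}|lborel. g r))"
    by (intro borel_integrable_atLeastAtMost' continuous_intros continuous_on_subset [OF f(2)]) auto
  have "(LINT s:{0..t}|lborel. f' s * (LINT r:{0..t}|lborel. g' r * min s r)) =
      (LINT s:{0..t}|lborel. g t * (f' s * s) - f' s * (LINT r:{0..s}|lborel. g r))"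
    by (intro set_lebesgue_integral_cong) (auto simp: inner algebra_simps)
  also have "\<dots> = g t * (LINT s:{0..t}|lborel. f' s * s) -
      (LINT s:{0..t}|lborel. f' s * (LINT r:{0..s}|lborel. g r))"
    using int1 int2 by simp
  also have "(LINT s:{0..t}|lborel. f' s * (LINT r:{0..s}|lborel. g r)) =
      f t * (LINT s:{0..t}|lborel. g s) - (LINT s:{0..t}|lborel. f s * g s)"
    using integral_by_parts_primitive [OF t int_g f] by simp
  finally show ?thesis
    unfolding lin [OF g] by (simp add: algebra_simps)
qed

section \<open>Wiener integrals of smooth functions\<close>

lemma integrable_mult_of_squares:
  fixes f g :: "'a \<Rightarrow> real"
  assumes [measurable]: "f \<in> borel_measurable M" "g \<in> borel_measurable M"
    and "integrable M (\<lambda>x. (f x)\<^sup>2)" "integrable M (\<lambda>x. (g x)\<^sup>2)"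
  shows "integrable M (\<lambda>x. f x * g x)"
proof (rule Bochner_Integration.integrable_bound)
  show "integrable M (\<lambda>x. (f x)\<^sup>2 + (g x)\<^sup>2)" using assms by simp
  have "\<bar>a * b\<bar> \<le> a\<^sup>2 + b\<^sup>2" for a b :: real
    using sum_squares_bound [of "\<bar>a\<bar>" "\<bar>b\<bar>"] abs_ge_zero [of "a * b"]
    unfolding abs_mult power2_abs by linarith
  then show "AE x in M. norm (f x * g x) \<le> norm ((f x)\<^sup>2 + (g x)\<^sup>2)" by simp
qed simp

text \<open>
  A Cauchy-Schwarz bound, with a constant weakened so that null measures need no special case.
\<close>

lemma (in finite_measure) square_integral_le:
  fixes f :: "'a \<Rightarrow> real"
  assumes [measurable]: "f \<in> borel_measurable M" and sq: "integrable M (\<lambda>x. (f x)\<^sup>2)"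
  shows "(\<integral>x. f x \<partial>M)\<^sup>2 \<le> (1 + measure M (space M))\<^sup>2 * (\<integral>x. (f x)\<^sup>2 \<partial>M)"
proof -
  define m where "m = (\<integral>x. f x \<partial>M)"
  define c where "c = 1 + measure M (space M)"
  have f: "integrable M f" by (rule square_integrable_imp_integrable [OF _ sq]) simp
  \<comment> \<open>The sharp bound would use the total mass instead of \<open>c\<close>; the extra \<open>1\<close> keeps the coefficient of
      \<open>m\<^sup>2\<close> positive.\<close>
  have "0 \<le> (\<integral>x. (c * f x - m)\<^sup>2 \<partial>M)" by simp
  also have "\<dots> = (\<integral>x. c\<^sup>2 * (f x)\<^sup>2 - 2 * c * m * f x + m\<^sup>2 \<partial>M)"
    by (intro Bochner_Integration.integral_cong) (auto simp: power2_eq_square algebra_simps)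
  also have "\<dots> = c\<^sup>2 * (\<integral>x. (f x)\<^sup>2 \<partial>M) - 2 * c * m * m + m\<^sup>2 * (c - 1)"
    using f sq by (simp add: m_def c_def)
  finally have "m\<^sup>2 * (c + 1) \<le> c\<^sup>2 * (\<integral>x. (f x)\<^sup>2 \<partial>M)"
    by (simp add: power2_eq_square algebra_simps)
  moreover have "m\<^sup>2 * 1 \<le> m\<^sup>2 * (c + 1)"
    by (rule mult_left_mono) (auto simp: c_def)
  ultimately show ?thesis by (simp add: m_def c_def)
qed

text \<open>
  Integrating a square-integrable process over a time axis of finite measure gives a
  square-integrable random variable.
\<close>

lemma time_integral_square_integrable:
  fixes g :: "'s \<times> 'a \<Rightarrow> real"
  assumes "finite_measure S" "finite_measure M"
    and g [measurable]: "g \<in> borel_measurable (S \<Otimes>\<^sub>M M)"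
    and sq: "integrable (S \<Otimes>\<^sub>M M) (\<lambda>p. (g p)\<^sup>2)"
  shows "(\<lambda>\<omega>. \<integral>s. g (s, \<omega>) \<partial>S) \<in> borel_measurable M"
    and "integrable M (\<lambda>\<omega>. (\<integral>s. g (s, \<omega>) \<partial>S)\<^sup>2)"
proof -
  interpret S: finite_measure S by fact
  interpret M: finite_measure M by fact
  interpret pair_sigma_finite S M ..
  show [measurable]: "(\<lambda>\<omega>. \<integral>s. g (s, \<omega>) \<partial>S) \<in> borel_measurable M" by measurable
  have int: "integrable M (\<lambda>\<omega>. \<integral>s. (g (s, \<omega>))\<^sup>2 \<partial>S)"
    using sq by (intro integrable_snd) (simp add: split_beta')
  show "integrable M (\<lambda>\<omega>. (\<integral>s. g (s, \<omega>) \<partial>S)\<^sup>2)"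
  proof (rule Bochner_Integration.integrable_bound)
    show "integrable M (\<lambda>\<omega>. (1 + measure S (space S))\<^sup>2 * (\<integral>s. (g (s, \<omega>))\<^sup>2 \<partial>S))"
      using int by simp
    have "AE \<omega> in M. integrable S (\<lambda>s. (g (s, \<omega>))\<^sup>2)"
      using sq by (intro AE_integrable_snd) (simp add: split_beta')
    then show "AE \<omega> in M. norm ((\<integral>s. g (s, \<omega>) \<partial>S)\<^sup>2) \<le>
        norm ((1 + measure S (space S))\<^sup>2 * (\<integral>s. (g (s, \<omega>))\<^sup>2 \<partial>S))"
      using AE_space
    proof eventually_elim
      case (elim \<omega>)
      then have "(\<lambda>s. g (s, \<omega>)) \<in> borel_measurable S" by measurable
      then show ?case using S.square_integral_le elim by simp
    qed
  qed simp
qed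

lemma expectation_time_integral_mult:
  fixes g :: "'s \<times> 'a \<Rightarrow> real"
  assumes "finite_measure S" "finite_measure M"
    and g [measurable]: "g \<in> borel_measurable (S \<Otimes>\<^sub>M M)"
    and sq: "integrable (S \<Otimes>\<^sub>M M) (\<lambda>p. (g p)\<^sup>2)"
    and Z [measurable]: "Z \<in> borel_measurable M" and Z2: "integrable M (\<lambda>\<omega>. (Z \<omega>)\<^sup>2)"
  shows "(\<integral>\<omega>. (\<integral>s. g (s, \<omega>) \<partial>S) * Z \<omega> \<partial>M) = (\<integral>s. (\<integral>\<omega>. g (s, \<omega>) * Z \<omega> \<partial>M) \<partial>S)"
proof -
  interpret S: finite_measure S by fact
  interpret M: finite_measure M by fact
  interpret pair_sigma_finite S M ..
  have "integrable (S \<Otimes>\<^sub>M M) (\<lambda>p. (Z (snd p))\<^sup>2)"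
    using Z2 by (intro Fubini_integrable) auto
  then have "integrable (S \<Otimes>\<^sub>M M) (\<lambda>p. g p * Z (snd p))"
    by (intro integrable_mult_of_squares sq) auto
  then have "(\<integral>\<omega>. (\<integral>s. g (s, \<omega>) * Z \<omega> \<partial>S) \<partial>M) = (\<integral>s. (\<integral>\<omega>. g (s, \<omega>) * Z \<omega> \<partial>M) \<partial>S)"
    by (intro Fubini_integral) (simp add: split_beta')
  then show ?thesis by simp
qed

context integrated_white_noise
begin

text \<open>
  The noise component \<open>k\<close>, extended to negative times by its value at \<open>0\<close>. The extension makes it jointly
  measurable on the whole time axis.
\<close>

definition noise :: "nat \<Rightarrow> real \<Rightarrow> 'a \<Rightarrow> real" where
  "noise k s \<omega> = W (max 0 s) \<omega> $ k"

text \<open>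
  The Wiener integral \<open>\<integral>\<^sub>0\<^sup>t f dW\<^sub>k\<close> of a smooth deterministic \<open>f\<close> with derivative \<open>f'\<close>, defined pathwise
  through integration by parts. The derivative is a parameter of the definition. No term at time
  \<open>0\<close> appears because \<open>W 0 = 0\<close> almost surely by the covariance condition.
\<close>

definition noise_integral :: "(real \<Rightarrow> real) \<Rightarrow> (real \<Rightarrow> real) \<Rightarrow> real \<Rightarrow> nat \<Rightarrow> 'a \<Rightarrow> real" where
  "noise_integral f f' t k \<omega> = f t * noise k t \<omega> - (LINT s:{0..t}|lborel. f' s * noise k s \<omega>)"

abbreviation time_measure :: "real \<Rightarrow> real measure" where
  "time_measure t \<equiv> restrict_space lborel {0..t}"

lemma noise_jointly_measurable:
  assumes "k < N"
  shows "(\<lambda>(s, \<omega>). noise k s \<omega>) \<in> borel_measurable (lborel \<Otimes>\<^sub>M M)"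
proof -
  have "(\<lambda>p. (max 0 (fst p), snd p)) \<in> lborel \<Otimes>\<^sub>M M \<rightarrow>\<^sub>M restrict_space borel {0::real..} \<Otimes>\<^sub>M M"
    by (intro measurable_Pair measurable_restrict_space2) (auto)
  from measurable_compose [OF this noise_measurable [OF assms]]
  show ?thesis by (simp add: noise_def split_beta')
qed

lemma noise_measurable_time [measurable]:
  "k < N \<Longrightarrow> noise k s \<in> borel_measurable M"
  using measurable_compose [OF measurable_Pair1' [of s lborel M] noise_jointly_measurable] by simp

lemma noise_second_moment: "k < N \<Longrightarrow> integrable M (\<lambda>\<omega>. (noise k s \<omega>)\<^sup>2)"
  by (simp add: noise_def noise_square_integrable)

lemma noise_covariance:
  "k < N \<Longrightarrow> l < N \<Longrightarrow> 0 \<le> s \<Longrightarrow> 0 \<le> r \<Longrightarrow>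
    expectation (\<lambda>\<omega>. noise k s \<omega> * noise l r \<omega>) = (if k = l then min s r else 0)"
  by (simp add: noise_def noise_cov)

lemma time_measure_finite: "finite_measure (time_measure t)"
  by (intro finite_measureI) (simp add: emeasure_restrict_space space_restrict_space emeasure_lborel_Icc_eq)

lemma weighted_noise_measurable:
  assumes "k < N" "continuous_on UNIV a"
  shows "(\<lambda>p. a (fst p) * noise k (fst p) (snd p)) \<in> borel_measurable (time_measure t \<Otimes>\<^sub>M M)"
proof -
  have [measurable]: "a \<in> borel_measurable borel"
    using assms(2) by (rule borel_measurable_continuous_onI)
  have "(\<lambda>p. (fst p, snd p)) \<in> time_measure t \<Otimes>\<^sub>M M \<rightarrow>\<^sub>M lborel \<Otimes>\<^sub>M M"
    by (intro measurable_Pair measurable_compose [OF measurable_fst] measurable_restrict_space1) auto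
  from measurable_compose [OF this noise_jointly_measurable [OF assms(1)]]
  have "(\<lambda>p. noise k (fst p) (snd p)) \<in> borel_measurable (time_measure t \<Otimes>\<^sub>M M)"
    by simp
  moreover have "a \<in> borel_measurable (time_measure t)"
    by (intro measurable_restrict_space1) simp
  ultimately show ?thesis by simp
qed

text \<open>
  The second moment of \<open>a s * W\<^sub>k s\<close> is \<open>(a s)\<^sup>2 * s\<close>, which is integrable over \<open>{0..t}\<close>.
\<close>

lemma weighted_noise_square_integrable:
  assumes k: "k < N" and a: "continuous_on UNIV a"
  shows "integrable (time_measure t \<Otimes>\<^sub>M M) (\<lambda>p. (a (fst p) * noise k (fst p) (snd p))\<^sup>2)"
proof -
  interpret T: finite_measure "time_measure t" by (rule time_measure_finite)
  interpret pair_sigma_finite "time_measure t" M ..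
  note [measurable] = weighted_noise_measurable [OF assms]
  have "set_integrable lborel {0..t} (\<lambda>s. (a s)\<^sup>2 * s)"
    by (intro borel_integrable_atLeastAtMost' continuous_intros continuous_on_subset [OF a]) auto
  moreover have "expectation (\<lambda>\<omega>. (a s * noise k s \<omega>)\<^sup>2) = (a s)\<^sup>2 * s" if "s \<in> {0..t}" for s
    using noise_covariance [OF k k, of s s] that
    by (simp add: power_mult_distrib power2_eq_square [of "noise _ _ _"])
  ultimately have "set_integrable lborel {0..t} (\<lambda>s. expectation (\<lambda>\<omega>. (a s * noise k s \<omega>)\<^sup>2))"
    by (subst set_integrable_cong [OF refl refl]) auto
  then have "integrable (time_measure t) (\<lambda>s. expectation (\<lambda>\<omega>. (a s * noise k s \<omega>)\<^sup>2))"
    by (simp add: set_integrable_def integrable_restrict_space)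
  then show ?thesis
    using noise_second_moment [OF k]
    by (intro Fubini_integrable borel_measurable_power weighted_noise_measurable assms)
      (simp_all add: power_mult_distrib)
qed

lemma set_integral_time_measure:
  "(LINT s:{0..t}|lborel. (f s :: real)) = (\<integral>s. f s \<partial>time_measure t)"
  by (simp add: set_lebesgue_integral_def integral_restrict_space)

lemma weighted_noise_integral:
  assumes k: "k < N" and a: "continuous_on UNIV a"
  shows "(\<lambda>\<omega>. LINT s:{0..t}|lborel. a s * noise k s \<omega>) \<in> borel_measurable M"
    and "integrable M (\<lambda>\<omega>. (LINT s:{0..t}|lborel. a s * noise k s \<omega>)\<^sup>2)"
    and "\<lbrakk>Z \<in> borel_measurable M; integrable M (\<lambda>\<omega>. (Z \<omega>)\<^sup>2)\<rbrakk> \<Longrightarrow>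
      expectation (\<lambda>\<omega>. (LINT s:{0..t}|lborel. a s * noise k s \<omega>) * Z \<omega>) =
      (LINT s:{0..t}|lborel. a s * expectation (\<lambda>\<omega>. noise k s \<omega> * Z \<omega>))"
  using time_integral_square_integrable [OF time_measure_finite finite_measure_axioms
      weighted_noise_measurable weighted_noise_square_integrable, OF assms assms, of t]
    expectation_time_integral_mult [OF time_measure_finite finite_measure_axioms
      weighted_noise_measurable weighted_noise_square_integrable, OF assms assms, of Z t]
  by (simp_all add: set_integral_time_measure mult.assoc)

lemma noise_integral_square_integrable:
  assumes k: "k < N" and f': "continuous_on UNIV f'"
  shows "noise_integral f f' t k \<in> borel_measurable M"
    and "integrable M (\<lambda>\<omega>. (noise_integral f f' t k \<omega>)\<^sup>2)"
proof -
  note [measurable] = weighted_noise_integral(1) [OF assms]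
  note sq = weighted_noise_integral(2) [OF assms, of t]
  show "noise_integral f f' t k \<in> borel_measurable M"
    unfolding noise_integral_def [abs_def] using k by measurable
  have "integrable M (\<lambda>\<omega>. (f t)\<^sup>2 * (noise k t \<omega>)\<^sup>2 - 2 * f t * (noise k t \<omega> *
      (LINT s:{0..t}|lborel. f' s * noise k s \<omega>)) + (LINT s:{0..t}|lborel. f' s * noise k s \<omega>)\<^sup>2)"
    using k by (intro Bochner_Integration.integrable_add Bochner_Integration.integrable_diff
        integrable_mult_right integrable_mult_of_squares sq noise_second_moment) measurable
  then show "integrable M (\<lambda>\<omega>. (noise_integral f f' t k \<omega>)\<^sup>2)"
    by (simp add: noise_integral_def power2_diff power_mult_distrib algebra_simps)
qed

text \<open>
  The Wiener isometry.
\<close>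

lemma noise_integral_covariance:
  assumes t: "0 \<le> t" and k: "k < N" and l: "l < N"
    and f: "\<And>s. (f has_real_derivative f' s) (at s)" "continuous_on UNIV f'"
    and g: "\<And>s. (g has_real_derivative g' s) (at s)" "continuous_on UNIV g'"
  shows "expectation (\<lambda>\<omega>. noise_integral f f' t k \<omega> * noise_integral g g' t l \<omega>) =
    (if k = l then (LINT s:{0..t}|lborel. f s * g s) else 0)"
proof -
  define c :: real where "c = (if k = l then 1 else 0)"
  define F where "F \<omega> = (LINT s:{0..t}|lborel. f' s * noise k s \<omega>)" for \<omega>
  define G where "G \<omega> = (LINT s:{0..t}|lborel. g' s * noise l s \<omega>)" for \<omega>
  have cov: "expectation (\<lambda>\<omega>. noise k s \<omega> * noise l r \<omega>) = c * min s r" if "0 \<le> s" "0 \<le> r" for s r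
    using noise_covariance [OF k l that] by (simp add: c_def)
  note [measurable] = noise_measurable_time [OF k] noise_measurable_time [OF l]
  have [measurable]: "F \<in> borel_measurable M" "G \<in> borel_measurable M"
    and sqF: "integrable M (\<lambda>\<omega>. (F \<omega>)\<^sup>2)" and sqG: "integrable M (\<lambda>\<omega>. (G \<omega>)\<^sup>2)"
    using weighted_noise_integral(1,2) [OF k f(2)] weighted_noise_integral(1,2) [OF l g(2)]
    by (simp_all add: F_def [abs_def] G_def [abs_def])
  note sq = sqF sqG noise_second_moment [OF k] noise_second_moment [OF l]
  have kG: "expectation (\<lambda>\<omega>. noise k s \<omega> * G \<omega>) = c * (LINT r:{0..t}|lborel. g' r * min s r)"
    if s: "0 \<le> s" for s
  proof -
    have "expectation (\<lambda>\<omega>. noise k s \<omega> * G \<omega>) = expectation (\<lambda>\<omega>. G \<omega> * noise k s \<omega>)"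
      by (simp add: mult.commute)
    also have "\<dots> = (LINT r:{0..t}|lborel. g' r * expectation (\<lambda>\<omega>. noise l r \<omega> * noise k s \<omega>))"
      unfolding G_def by (rule weighted_noise_integral(3) [OF l g(2)]) (auto intro: sq)
    also have "\<dots> = (LINT r:{0..t}|lborel. c * (g' r * min s r))"
      using s by (intro set_lebesgue_integral_cong) (auto simp: cov mult.commute [of "noise l _ _"])
    finally show ?thesis by simp
  qed
  have Fl: "expectation (\<lambda>\<omega>. F \<omega> * noise l t \<omega>) = c * (LINT s:{0..t}|lborel. f' s * s)"
  proof -
    have "expectation (\<lambda>\<omega>. F \<omega> * noise l t \<omega>) =
        (LINT s:{0..t}|lborel. f' s * expectation (\<lambda>\<omega>. noise k s \<omega> * noise l t \<omega>))"
      unfolding F_def by (rule weighted_noise_integral(3) [OF k f(2)]) (auto intro: sq)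
    also have "\<dots> = (LINT s:{0..t}|lborel. c * (f' s * s))"
      using t by (intro set_lebesgue_integral_cong) (auto simp: cov min_def)
    finally show ?thesis by simp
  qed
  have FG: "expectation (\<lambda>\<omega>. F \<omega> * G \<omega>) =
      c * (LINT s:{0..t}|lborel. f' s * (LINT r:{0..t}|lborel. g' r * min s r))"
  proof -
    have "expectation (\<lambda>\<omega>. F \<omega> * G \<omega>) =
        (LINT s:{0..t}|lborel. f' s * expectation (\<lambda>\<omega>. noise k s \<omega> * G \<omega>))"
      unfolding F_def by (rule weighted_noise_integral(3) [OF k f(2)]) (auto intro: sq)
    also have "\<dots> = (LINT s:{0..t}|lborel. c * (f' s * (LINT r:{0..t}|lborel. g' r * min s r)))"
      by (intro set_lebesgue_integral_cong) (auto simp: kG)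
    finally show ?thesis by simp
  qed
  have kGt: "(LINT r:{0..t}|lborel. g' r * min t r) = (LINT r:{0..t}|lborel. g' r * r)"
    by (intro set_lebesgue_integral_cong) (auto simp: min_def)
  have "expectation (\<lambda>\<omega>. noise_integral f f' t k \<omega> * noise_integral g g' t l \<omega>) =
      expectation (\<lambda>\<omega>. f t * g t * (noise k t \<omega> * noise l t \<omega>) - f t * (noise k t \<omega> * G \<omega>)
        - g t * (F \<omega> * noise l t \<omega>) + F \<omega> * G \<omega>)"
    by (intro Bochner_Integration.integral_cong)
      (auto simp: noise_integral_def F_def G_def algebra_simps)
  also have "\<dots> = f t * g t * expectation (\<lambda>\<omega>. noise k t \<omega> * noise l t \<omega>)
      - f t * expectation (\<lambda>\<omega>. noise k t \<omega> * G \<omega>) - g t * expectation (\<lambda>\<omega>. F \<omega> * noise l t \<omega>)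
      + expectation (\<lambda>\<omega>. F \<omega> * G \<omega>)"
    using integrable_mult_of_squares [of "noise k t" M "noise l t"]
      integrable_mult_of_squares [of "noise k t" M G]
      integrable_mult_of_squares [of F M "noise l t"]
      integrable_mult_of_squares [of F M G] sq by simp
  also have "\<dots> = c * (f t * g t * t - f t * (LINT r:{0..t}|lborel. g' r * r)
      - g t * (LINT s:{0..t}|lborel. f' s * s)
      + (LINT s:{0..t}|lborel. f' s * (LINT r:{0..t}|lborel. g' r * min s r)))"
    unfolding cov [OF t t] kG [OF t] Fl FG kGt by (simp add: algebra_simps)
  also have "\<dots> = c * (LINT s:{0..t}|lborel. f s * g s)"
    unfolding covariance_identity [OF t f g] ..
  finally show ?thesis by (simp add: c_def)
qed

end

section \<open>Variation of constants on the chain\<close>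

text \<open>
  The entry \<open>(i, k)\<close> of \<open>e\<^bsup>-L u\<^esup> L\<close>, which is the negative derivative of the kernel.
\<close>

definition kernel_slope :: "nat \<Rightarrow> nat \<Rightarrow> real \<Rightarrow> real" where
  "kernel_slope i k u = lattice_kernel i k u - lattice_kernel i (Suc k) u"

lemma continuous_on_lattice_kernel [continuous_intros]:
  "continuous_on A f \<Longrightarrow> continuous_on A (\<lambda>s. lattice_kernel i k (f s))"
  unfolding lattice_kernel_def by (cases "k \<le> i") (simp_all add: continuous_intros)

lemma continuous_on_kernel_slope [continuous_intros]:
  "continuous_on A f \<Longrightarrow> continuous_on A (\<lambda>s. kernel_slope i k (f s))"
  unfolding kernel_slope_def by (intro continuous_intros)

lemma kernel_reversed_has_derivative:
  "((\<lambda>s. lattice_kernel i k (t - s)) has_real_derivative kernel_slope i k (t - s)) (at s)"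
proof -
  have "((\<lambda>s. t - s) has_real_derivative - 1) (at s)"
    by (auto intro!: derivative_eq_intros)
  from DERIV_chain2 [OF lattice_kernel_has_derivative this]
  show ?thesis by (simp add: kernel_slope_def)
qed

lemma kernel_slope_reversed_has_derivative:
  "((\<lambda>s. kernel_slope i k (t - s)) has_real_derivative
     kernel_slope i k (t - s) - kernel_slope i (Suc k) (t - s)) (at s)"
  using DERIV_diff [OF kernel_reversed_has_derivative [of i k t s]
      kernel_reversed_has_derivative [of i "Suc k" t s]]
  by (simp add: kernel_slope_def [of i k])

text \<open>
  Variation of constants for the chain, for a single path. The forcing \<open>w\<close> is not differentiable, so the
  convolution of the kernel with its derivative is replaced by a boundary term minus the convolution
  of \<open>w\<close> with the slope of the kernel. The proof expresses \<open>w\<close> through \<open>x\<close> and its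
  primitives, integrates by parts, and sums over the chain, where all convolution terms telescope.
\<close>

lemma lattice_chain_solution:
  fixes x w :: "nat \<Rightarrow> real \<Rightarrow> real" and c :: "nat \<Rightarrow> real"
  assumes t: "0 \<le> t" and i: "i < N"
    and int: "\<And>k. k < N \<Longrightarrow> set_integrable lborel {0..t} (x k)"
    and eq: "\<And>k s. \<lbrakk>k < N; 0 \<le> s; s \<le> t\<rbrakk> \<Longrightarrow> x k s = c k - ((LINT r:{0..s}|lborel. x k r) -
      (if k = 0 then 0 else (LINT r:{0..s}|lborel. x (k - 1) r))) + w k s"
  shows "x i t = (\<Sum>k<N. lattice_kernel i k t * c k) +
    (\<Sum>k<N. lattice_kernel i k 0 * w k t - (LINT s:{0..t}|lborel. kernel_slope i k (t - s) * w k s))"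
proof -
  define X where "X k s = (LINT r:{0..s}|lborel. x k r)" for k s
  \<comment> \<open>\<open>P\<close> holds the predecessor's primitive, which is \<open>0\<close> for the first follower behind the leader.\<close>
  define P where "P k s = (if k = 0 then 0 else X (k - 1) s)" for k s
  define Q where "Q k = (LINT s:{0..t}|lborel. kernel_slope i k (t - s) * P k s)" for k
  have eq': "w k s = x k s - c k + X k s - P k s" if "k < N" "0 \<le> s" "s \<le> t" for k s
    using eq [OF that] by (simp add: X_def P_def)
  have contX: "continuous_on {0..t} (X k)" if "k < N" for k
    using continuous_on_primitive [OF int [OF that]] by (simp add: X_def [abs_def])
  have contP: "continuous_on {0..t} (P k)" if "k < N" for k
    using contX [of "k - 1"] that unfolding P_def [abs_def] by (cases k) simp_all
  have kernel_sum: "(\<Sum>k<N. lattice_kernel i k 0 * a k) = a i" for a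
  proof -
    have "(\<Sum>k<N. lattice_kernel i k 0 * a k) = (\<Sum>k<N. if k = i then a k else 0)"
      by (intro sum.cong) (auto simp: lattice_kernel_at_0)
    then show ?thesis using i by simp
  qed
  have slope_sum: "(\<Sum>k<N. kernel_slope i k 0 * X k t) = X i t - P i t"
  proof -
    have "(\<Sum>k<N. kernel_slope i k 0 * X k t) =
        (\<Sum>k<N. lattice_kernel i k 0 * X k t) - (\<Sum>k<N. lattice_kernel i (Suc k) 0 * X k t)"
      by (simp add: kernel_slope_def algebra_simps sum_subtractf)
    also have "(\<Sum>k<N. lattice_kernel i (Suc k) 0 * X k t) = (\<Sum>k<N. if i = Suc k then X k t else 0)"
      by (intro sum.cong) (auto simp: lattice_kernel_at_0)
    also have "\<dots> = P i t" using i by (cases i) (auto simp: P_def)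
    finally show ?thesis by (simp add: kernel_sum)
  qed
  have main: "(LINT s:{0..t}|lborel. kernel_slope i k (t - s) * w k s) =
      kernel_slope i k 0 * X k t - c k * (lattice_kernel i k 0 - lattice_kernel i k t) + Q (Suc k) - Q k"
    if k: "k < N" for k
  proof -
    have ibp: "(LINT s:{0..t}|lborel. kernel_slope i k (t - s) * x k s) = kernel_slope i k 0 * X k t -
        (LINT s:{0..t}|lborel. (kernel_slope i k (t - s) - kernel_slope i (Suc k) (t - s)) * X k s)"
      using integral_by_parts_primitive [OF t int [OF k] kernel_slope_reversed_has_derivative [of i k t]]
      by (simp add: X_def continuous_intros)
    have ftc: "(LINT s:{0..t}|lborel. kernel_slope i k (t - s)) = lattice_kernel i k 0 - lattice_kernel i k t"
    proof -
      have "(LINT s:{0..t}|lborel. kernel_slope i k (t - s)) =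
          lattice_kernel i k (t - t) - lattice_kernel i k (t - 0)"
        unfolding set_lebesgue_integral_def using t
        by (intro integral_FTC_atLeastAtMost)
          (auto simp flip: has_real_derivative_iff_has_vector_derivative
            intro!: has_field_derivative_at_within kernel_reversed_has_derivative continuous_intros)
      then show ?thesis by simp
    qed
    have [simp]: "P (Suc k) = X k" by (simp add: P_def fun_eq_iff)
    have i1: "set_integrable lborel {0..t} (\<lambda>s. kernel_slope i l (t - s) * X k s)" for l
      by (intro borel_integrable_atLeastAtMost' continuous_intros contX k)
    have i2: "set_integrable lborel {0..t} (\<lambda>s. kernel_slope i k (t - s) * P k s)"
      by (intro borel_integrable_atLeastAtMost' continuous_intros contP k)
    have i3: "set_integrable lborel {0..t} (\<lambda>s. kernel_slope i k (t - s))"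
      by (intro borel_integrable_atLeastAtMost' continuous_intros)
    have i4: "set_integrable lborel {0..t} (\<lambda>s. kernel_slope i k (t - s) * x k s)"
      by (intro set_integrable_continuous_mult int k continuous_intros)
    have "(LINT s:{0..t}|lborel. kernel_slope i k (t - s) * w k s) =
        (LINT s:{0..t}|lborel. kernel_slope i k (t - s) * x k s - c k * kernel_slope i k (t - s)
          + kernel_slope i k (t - s) * X k s - kernel_slope i k (t - s) * P k s)"
      using k by (intro set_lebesgue_integral_cong) (auto simp: eq' algebra_simps)
    also have "\<dots> = (LINT s:{0..t}|lborel. kernel_slope i k (t - s) * x k s)
        - c k * (lattice_kernel i k 0 - lattice_kernel i k t)
        + (LINT s:{0..t}|lborel. kernel_slope i k (t - s) * X k s) - Q k"
      using i1 i2 i3 i4 by (simp add: ftc Q_def)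
    also have "(LINT s:{0..t}|lborel. kernel_slope i k (t - s) * x k s) = kernel_slope i k 0 * X k t -
        (LINT s:{0..t}|lborel. kernel_slope i k (t - s) * X k s) + Q (Suc k)"
      using i1 by (simp add: ibp Q_def left_diff_distrib)
    finally show ?thesis by simp
  qed
  \<comment> \<open>The ends of the telescope: the leader rests at \<open>0\<close>, and the kernel vanishes above the diagonal.\<close>
  have "Q 0 = 0" by (simp add: Q_def P_def)
  moreover have "Q N = 0" using i by (simp add: Q_def kernel_slope_def lattice_kernel_eq_0)
  ultimately have Q: "(\<Sum>k<N. Q (Suc k) - Q k) = 0" by (simp add: sum_lessThan_telescope)
  have "(\<Sum>k<N. lattice_kernel i k 0 * w k t - (LINT s:{0..t}|lborel. kernel_slope i k (t - s) * w k s)) =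
      (\<Sum>k<N. lattice_kernel i k 0 * w k t) - (\<Sum>k<N. kernel_slope i k 0 * X k t)
      + (\<Sum>k<N. lattice_kernel i k 0 * c k) - (\<Sum>k<N. lattice_kernel i k t * c k)
      - (\<Sum>k<N. Q (Suc k) - Q k)"
    unfolding sum_subtractf [symmetric] sum.distrib [symmetric]
  proof (rule sum.cong [OF refl])
    fix k assume "k \<in> {..<N}"
    then have k: "k < N" by simp
    show "lattice_kernel i k 0 * w k t - (LINT s:{0..t}|lborel. kernel_slope i k (t - s) * w k s) =
        lattice_kernel i k 0 * w k t - kernel_slope i k 0 * X k t + lattice_kernel i k 0 * c k
        - lattice_kernel i k t * c k - (Q (Suc k) - Q k)"
      unfolding main [OF k] by (simp add: algebra_simps)
  qed
  also have "\<dots> = w i t - (X i t - P i t) + c i - (\<Sum>k<N. lattice_kernel i k t * c k)"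
    by (simp add: kernel_sum slope_sum Q)
  finally show ?thesis using eq' [OF i t order_refl] by simp
qed

section \<open>Convergence of the second moments\<close>

lemma lattice_kernel_tendsto_0: "(lattice_kernel i k \<longlongrightarrow> 0) at_top"
proof (cases "k \<le> i")
  case True
  have "((\<lambda>u. (u ^ (i - k) / exp u) / fact (i - k)) \<longlongrightarrow> 0 / fact (i - k)) (at_top :: real filter)"
    by (intro tendsto_intros tendsto_power_div_exp_0) simp
  moreover have "lattice_kernel i k = (\<lambda>u. (u ^ (i - k) / exp u) / fact (i - k))"
    using True by (simp only: lattice_kernel_def [abs_def] if_True exp_minus divide_inverse mult.commute)
  ultimately show ?thesis by simp
qed (simp add: lattice_kernel_def [abs_def])

lemma integral_double_sum:
  fixes f :: "'i \<Rightarrow> 'j \<Rightarrow> 'a \<Rightarrow> real"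
  assumes "\<And>k l. k \<in> A \<Longrightarrow> l \<in> B \<Longrightarrow> integrable M (f k l)"
  shows "(\<integral>\<omega>. (\<Sum>k\<in>A. \<Sum>l\<in>B. f k l \<omega>) \<partial>M) = (\<Sum>k\<in>A. \<Sum>l\<in>B. \<integral>\<omega>. f k l \<omega> \<partial>M)"
proof -
  have "(\<integral>\<omega>. (\<Sum>k\<in>A. \<Sum>l\<in>B. f k l \<omega>) \<partial>M) = (\<Sum>k\<in>A. \<integral>\<omega>. (\<Sum>l\<in>B. f k l \<omega>) \<partial>M)"
    using assms by (intro Bochner_Integration.integral_sum Bochner_Integration.integrable_sum)
  also have "\<dots> = (\<Sum>k\<in>A. \<Sum>l\<in>B. \<integral>\<omega>. f k l \<omega> \<partial>M)"
    using assms by (intro sum.cong refl Bochner_Integration.integral_sum)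
  finally show ?thesis .
qed

lemma set_integral_reflect:
  fixes f :: "real \<Rightarrow> real"
  shows "(LINT s:{0..t}|lborel. f (t - s)) = (LINT s:{0..t}|lborel. f s)"
proof -
  have "(LINT s:{0..t}|lborel. f s) = (\<integral>s. indicator {0..t} (t + (- 1) * s) *\<^sub>R f (t + (- 1) * s) \<partial>lborel)"
    using lborel_integral_real_affine [of "- 1" "\<lambda>s. indicator {0..t} s *\<^sub>R f s" t]
    by (simp add: set_lebesgue_integral_def)
  also have "\<dots> = (LINT s:{0..t}|lborel. f (t - s))"
    unfolding set_lebesgue_integral_def
    by (intro Bochner_Integration.integral_cong) (auto simp: indicator_def)
  finally show ?thesis ..
qed

context leader_follower
begin

text \<open>
  The contribution \<open>e\<^bsup>-L t\<^esup> x(0)\<close> of the initial state to component \<open>i\<close>.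
\<close>

definition free_response :: "nat \<Rightarrow> real \<Rightarrow> 'a \<Rightarrow> real" where
  "free_response i t \<omega> = (\<Sum>k<N. lattice_kernel i k t * x 0 \<omega> $ k)"

text \<open>
  The contribution of the disturbance to component \<open>i\<close>: the sum over \<open>k\<close> of the Wiener integrals of
  \<open>s \<mapsto> (e\<^bsup>-L (t - s)\<^esup>)\<^bsub>i k\<^esub>\<close>.
\<close>

definition noise_response :: "nat \<Rightarrow> real \<Rightarrow> 'a \<Rightarrow> real" where
  "noise_response i t \<omega> = (\<Sum>k<N. noise_integral (\<lambda>s. lattice_kernel i k (t - s))
     (\<lambda>s. kernel_slope i k (t - s)) t k \<omega>)"

lemma state_eq_response:
  assumes t: "0 \<le> t"
  shows "AE \<omega> in M. \<forall>i<N. x t \<omega> $ i = free_response i t \<omega> + noise_response i t \<omega>"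
  using dynamics AE_space
proof eventually_elim
  case (elim \<omega>)
  have int: "set_integrable lborel {0..s} (\<lambda>s. x s \<omega> $ k)" if "k < N" "0 \<le> s" for k s
    using elim(1) that by blast
  have \<omega>: "\<omega> \<in> space M" by (rule elim(2))
  have dyn: "x s \<omega> $ k = x 0 \<omega> $ k - (LINT r:{0..s}|lborel. (lattice_matrix N *\<^sub>v x r \<omega>) $ k)
      + W s \<omega> $ k" if "k < N" "0 \<le> s" for k s
    using elim(1) that by blast
  show ?case
  proof (intro allI impI)
    fix i assume i: "i < N"
    have "x t \<omega> $ i = (\<Sum>k<N. lattice_kernel i k t * (x 0 \<omega> $ k)) +
      (\<Sum>k<N. lattice_kernel i k 0 * noise k t \<omega> -
         (LINT s:{0..t}|lborel. kernel_slope i k (t - s) * noise k s \<omega>))"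
    proof (rule lattice_chain_solution [where x = "\<lambda>k s. x s \<omega> $ k", OF t i])
      fix k s assume k: "k < N" and s: "0 \<le> s" "s \<le> t"
      have "(LINT r:{0..s}|lborel. (lattice_matrix N *\<^sub>v x r \<omega>) $ k) =
          (LINT r:{0..s}|lborel. x r \<omega> $ k - (if k = 0 then 0 else x r \<omega> $ (k - 1)))"
        by (intro set_lebesgue_integral_cong) (auto simp: lattice_matrix_mult_vec [OF state_dim [OF _ \<omega>] k]
            simp del: index_mult_mat_vec)
      also have "\<dots> = (LINT r:{0..s}|lborel. x r \<omega> $ k) -
          (if k = 0 then 0 else (LINT r:{0..s}|lborel. x r \<omega> $ (k - 1)))"
        using int [OF k s(1)] int [of "k - 1" s] k s by auto
      finally show "x s \<omega> $ k = x 0 \<omega> $ k - ((LINT r:{0..s}|lborel. x r \<omega> $ k) -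
          (if k = 0 then 0 else (LINT r:{0..s}|lborel. x r \<omega> $ (k - 1)))) + noise k s \<omega>"
        using dyn [OF k s(1)] s(1) by (simp add: noise_def)
    qed (rule int [OF _ t])
    then show "x t \<omega> $ i = free_response i t \<omega> + noise_response i t \<omega>"
      by (simp add: free_response_def noise_response_def noise_integral_def)
  qed
qed

lemma initial_measurable [measurable]: "k < N \<Longrightarrow> (\<lambda>\<omega>. x 0 \<omega> $ k) \<in> borel_measurable M"
  using state_measurable by simp

lemma noise_term_square_integrable:
  assumes "k < N"
  shows "noise_integral f (\<lambda>s. kernel_slope i k (t - s)) t k \<in> borel_measurable M"
    and "integrable M (\<lambda>\<omega>. (noise_integral f (\<lambda>s. kernel_slope i k (t - s)) t k \<omega>)\<^sup>2)"
  using assms by (auto intro!: noise_integral_square_integrable continuous_intros)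

lemma noise_response_covariance:
  assumes t: "0 \<le> t"
  shows "integrable M (\<lambda>\<omega>. noise_response i t \<omega> * noise_response j t \<omega>)"
    and "expectation (\<lambda>\<omega>. noise_response i t \<omega> * noise_response j t \<omega>) =
      (LINT s:{0..t}|lborel. (\<Sum>k<N. lattice_kernel i k s * lattice_kernel j k s))"
proof -
  define I where "I i k = noise_integral (\<lambda>s. lattice_kernel i k (t - s))
     (\<lambda>s. kernel_slope i k (t - s)) t k" for i k
  have int: "integrable M (\<lambda>\<omega>. I i k \<omega> * I j l \<omega>)" if "k < N" "l < N" for k l
    unfolding I_def using that by (intro integrable_mult_of_squares noise_term_square_integrable)
  have prod: "noise_response i t \<omega> * noise_response j t \<omega> = (\<Sum>k<N. \<Sum>l<N. I i k \<omega> * I j l \<omega>)" for \<omega>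
    by (simp add: noise_response_def I_def sum_product)
  show "integrable M (\<lambda>\<omega>. noise_response i t \<omega> * noise_response j t \<omega>)"
    unfolding prod by (intro Bochner_Integration.integrable_sum int) auto
  have cov: "expectation (\<lambda>\<omega>. I i k \<omega> * I j l \<omega>) =
      (if k = l then (LINT s:{0..t}|lborel. lattice_kernel i k s * lattice_kernel j k s) else 0)"
    if "k < N" "l < N" for k l
  proof -
    have "expectation (\<lambda>\<omega>. I i k \<omega> * I j l \<omega>) =
        (if k = l then (LINT s:{0..t}|lborel. lattice_kernel i k (t - s) * lattice_kernel j l (t - s)) else 0)"
      unfolding I_def
      by (intro noise_integral_covariance t that kernel_reversed_has_derivative continuous_intros)
    then show ?thesis
      using set_integral_reflect [of t "\<lambda>s. lattice_kernel i k s * lattice_kernel j k s"]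
      by (cases "k = l") simp_all
  qed
  have "expectation (\<lambda>\<omega>. noise_response i t \<omega> * noise_response j t \<omega>) =
      (\<Sum>k<N. \<Sum>l<N. expectation (\<lambda>\<omega>. I i k \<omega> * I j l \<omega>))"
    unfolding prod using int by (intro integral_double_sum) auto
  also have "\<dots> = (\<Sum>k<N. LINT s:{0..t}|lborel. lattice_kernel i k s * lattice_kernel j k s)"
    by (intro sum.cong refl) (simp add: cov)
  also have "\<dots> = (LINT s:{0..t}|lborel. (\<Sum>k<N. lattice_kernel i k s * lattice_kernel j k s))"
    unfolding set_lebesgue_integral_def scaleR_sum_right
  proof (rule Bochner_Integration.integral_sum [symmetric])
    fix k
    have "set_integrable lborel {0..t} (\<lambda>s. lattice_kernel i k s * lattice_kernel j k s)"
      by (intro borel_integrable_atLeastAtMost' continuous_intros)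
    then show "integrable lborel (\<lambda>s. indicator {0..t} s *\<^sub>R (lattice_kernel i k s * lattice_kernel j k s))"
      by (simp add: set_integrable_def)
  qed
  finally show "expectation (\<lambda>\<omega>. noise_response i t \<omega> * noise_response j t \<omega>) =
      (LINT s:{0..t}|lborel. (\<Sum>k<N. lattice_kernel i k s * lattice_kernel j k s))" .
qed

text \<open>
  Without the initial state, the covariance at time \<open>t\<close> is the integral defining \<open>P\<close> truncated at \<open>t\<close>.
\<close>

lemma noise_response_covariance_limit:
  assumes "i < N" "j < N"
  shows "((\<lambda>t. expectation (\<lambda>\<omega>. noise_response i t \<omega> * noise_response j t \<omega>)) \<longlongrightarrow>
    steady_state_cov N $$ (i, j)) at_top"
proof -
  let ?h = "\<lambda>s. \<Sum>k<N. lattice_kernel i k s * lattice_kernel j k s"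
  have "set_integrable lborel {0..} ?h"
    unfolding set_integrable_def scaleR_sum_right
    by (intro Bochner_Integration.integrable_sum kernel_product_integrable [unfolded set_integrable_def])
  then have "((\<lambda>t. LINT s:{0..t}|lborel. ?h s) \<longlongrightarrow> (LINT s:{0..}|lborel. ?h s)) at_top"
    by (intro tendsto_set_lebesgue_integral_at_top) auto
  moreover have "eventually (\<lambda>t. (LINT s:{0..t}|lborel. ?h s) =
      expectation (\<lambda>\<omega>. noise_response i t \<omega> * noise_response j t \<omega>)) at_top"
    using eventually_ge_at_top [of 0] by eventually_elim (simp add: noise_response_covariance)
  ultimately show ?thesis
    unfolding steady_state_cov_eq [OF assms] by (rule Lim_transform_eventually)
qed

lemma noise_response_measurable [measurable]: "noise_response i t \<in> borel_measurable M"
  unfolding noise_response_def [abs_def] by (intro borel_measurable_sum noise_term_square_integrable) auto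

lemma noise_response_square_integrable:
  "0 \<le> t \<Longrightarrow> integrable M (\<lambda>\<omega>. (noise_response i t \<omega>)\<^sup>2)"
  using noise_response_covariance(1) [of t i i] by (simp add: power2_eq_square)

lemma initial_noise_integrable:
  assumes "k < N" "0 \<le> t"
  shows "integrable M (\<lambda>\<omega>. x 0 \<omega> $ k * noise_response j t \<omega>)"
  using assms
  by (intro integrable_mult_of_squares initial_square_integrable noise_response_square_integrable) auto

text \<open>
  The initial state may be correlated with the noise, so this mixed moment need not vanish. It tends to
  \<open>0\<close> because the kernel decays while the second moments of the noise response stay bounded.
\<close>

lemma free_noise_limit:
  assumes j: "j < N"
  shows "((\<lambda>t. expectation (\<lambda>\<omega>. free_response i t \<omega> * noise_response j t \<omega>)) \<longlongrightarrow> 0) at_top"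
proof -
  let ?c = "\<lambda>k t. expectation (\<lambda>\<omega>. x 0 \<omega> $ k * noise_response j t \<omega>)"
  let ?b = "\<lambda>k t. expectation (\<lambda>\<omega>. (x 0 \<omega> $ k)\<^sup>2) + expectation (\<lambda>\<omega>. noise_response j t \<omega> * noise_response j t \<omega>)"
  have lim: "((\<lambda>t. lattice_kernel i k t * ?c k t) \<longlongrightarrow> 0) at_top" if k: "k < N" for k
  proof (rule Lim_null_comparison)
    have "((\<lambda>t. \<bar>lattice_kernel i k t\<bar> * ?b k t) \<longlongrightarrow>
        \<bar>0\<bar> * (expectation (\<lambda>\<omega>. (x 0 \<omega> $ k)\<^sup>2) + steady_state_cov N $$ (j, j))) at_top"
      by (intro tendsto_intros lattice_kernel_tendsto_0 noise_response_covariance_limit j)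
    then show "((\<lambda>t. \<bar>lattice_kernel i k t\<bar> * ?b k t) \<longlongrightarrow> 0) at_top" by simp
    show "\<forall>\<^sub>F t in at_top. norm (lattice_kernel i k t * ?c k t) \<le> \<bar>lattice_kernel i k t\<bar> * ?b k t"
      using eventually_ge_at_top [of 0]
    proof eventually_elim
      case (elim t)
      have "\<bar>a * b\<bar> \<le> a\<^sup>2 + b * b" for a b :: real
        using sum_squares_bound [of "\<bar>a\<bar>" "\<bar>b\<bar>"] abs_ge_zero [of "a * b"]
        unfolding abs_mult power2_abs power2_eq_square by linarith
      then have "\<bar>?c k t\<bar> \<le> expectation (\<lambda>\<omega>. (x 0 \<omega> $ k)\<^sup>2 + noise_response j t \<omega> * noise_response j t \<omega>)"
        using k elim
        by (intro order_trans [OF integral_abs_bound] integral_mono integrable_abs initial_noise_integrable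
            Bochner_Integration.integrable_add initial_square_integrable noise_response_covariance) auto
      also have "\<dots> = ?b k t"
        using k elim by (intro Bochner_Integration.integral_add initial_square_integrable noise_response_covariance)
      finally show ?case by (simp add: abs_mult mult_left_mono)
    qed
  qed
  have "((\<lambda>t. \<Sum>k<N. lattice_kernel i k t * ?c k t) \<longlongrightarrow> (\<Sum>k<N. 0)) at_top"
    by (intro tendsto_sum lim) simp
  moreover have "eventually (\<lambda>t. (\<Sum>k<N. lattice_kernel i k t * ?c k t) =
      expectation (\<lambda>\<omega>. free_response i t \<omega> * noise_response j t \<omega>)) at_top"
    using eventually_ge_at_top [of 0]
  proof eventually_elim
    case (elim t)
    have "expectation (\<lambda>\<omega>. free_response i t \<omega> * noise_response j t \<omega>) =
        expectation (\<lambda>\<omega>. \<Sum>k<N. lattice_kernel i k t * (x 0 \<omega> $ k * noise_response j t \<omega>))"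
      by (simp add: free_response_def sum_distrib_right mult.assoc)
    also have "\<dots> = (\<Sum>k<N. expectation (\<lambda>\<omega>. lattice_kernel i k t * (x 0 \<omega> $ k * noise_response j t \<omega>)))"
      using elim initial_noise_integrable by (intro Bochner_Integration.integral_sum) auto
    finally show ?case by simp
  qed
  ultimately show ?thesis by (simp add: Lim_transform_eventually)
qed

lemma initial_integrable:
  "k < N \<Longrightarrow> l < N \<Longrightarrow> integrable M (\<lambda>\<omega>. x 0 \<omega> $ k * x 0 \<omega> $ l)"
  by (intro integrable_mult_of_squares initial_square_integrable) auto

lemma free_response_product:
  "free_response i t \<omega> * free_response j t \<omega> =
    (\<Sum>k<N. \<Sum>l<N. (lattice_kernel i k t * lattice_kernel j l t) * (x 0 \<omega> $ k * x 0 \<omega> $ l))"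
  by (simp add: free_response_def sum_product mult_ac)

lemma free_response_limit:
  "((\<lambda>t. expectation (\<lambda>\<omega>. free_response i t \<omega> * free_response j t \<omega>)) \<longlongrightarrow> 0) at_top"
proof -
  have "((\<lambda>t. \<Sum>k<N. \<Sum>l<N. (lattice_kernel i k t * lattice_kernel j l t) *
      expectation (\<lambda>\<omega>. x 0 \<omega> $ k * x 0 \<omega> $ l)) \<longlongrightarrow>
      (\<Sum>k<N. \<Sum>l<N. (0 * 0) * expectation (\<lambda>\<omega>. x 0 \<omega> $ k * x 0 \<omega> $ l))) at_top"
    by (intro tendsto_intros lattice_kernel_tendsto_0)
  moreover have "expectation (\<lambda>\<omega>. free_response i t \<omega> * free_response j t \<omega>) =
      (\<Sum>k<N. \<Sum>l<N. (lattice_kernel i k t * lattice_kernel j l t) *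
        expectation (\<lambda>\<omega>. x 0 \<omega> $ k * x 0 \<omega> $ l))" for t
  proof -
    let ?s = "\<lambda>k l \<omega>. (lattice_kernel i k t * lattice_kernel j l t) * (x 0 \<omega> $ k * x 0 \<omega> $ l)"
    have int: "integrable M (?s k l)" if "k < N" "l < N" for k l
      using initial_integrable [OF that] by simp
    have "expectation (\<lambda>\<omega>. free_response i t \<omega> * free_response j t \<omega>) =
        (\<Sum>k<N. \<Sum>l<N. expectation (?s k l))"
      unfolding free_response_product by (intro integral_double_sum int) auto
    then show ?thesis by simp
  qed
  ultimately show ?thesis by simp
qed

theorem covariance_tendsto_steady_state:
  assumes i: "i < N" and j: "j < N"
  shows "((\<lambda>t. expectation (\<lambda>\<omega>. x t \<omega> $ i * x t \<omega> $ j)) \<longlongrightarrow> steady_state_cov N $$ (i, j)) at_top"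
proof -
  let ?E = "\<lambda>f g t. expectation (\<lambda>\<omega>. f t \<omega> * g t \<omega>)"
  have "((\<lambda>t. ?E (free_response i) (free_response j) t + ?E (free_response i) (noise_response j) t
      + ?E (free_response j) (noise_response i) t + ?E (noise_response i) (noise_response j) t) \<longlongrightarrow>
      0 + 0 + 0 + steady_state_cov N $$ (i, j)) at_top"
    by (intro tendsto_add free_response_limit free_noise_limit noise_response_covariance_limit i j)
  moreover have "eventually (\<lambda>t. ?E (free_response i) (free_response j) t + ?E (free_response i) (noise_response j) t
      + ?E (free_response j) (noise_response i) t + ?E (noise_response i) (noise_response j) t =
      expectation (\<lambda>\<omega>. x t \<omega> $ i * x t \<omega> $ j)) at_top"
    using eventually_ge_at_top [of 0]
  proof eventually_elim
    case (elim t)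
    have ff: "integrable M (\<lambda>\<omega>. free_response i t \<omega> * free_response j t \<omega>)"
      unfolding free_response_product
      by (intro Bochner_Integration.integrable_sum integrable_mult_right initial_integrable) auto
    have fn: "integrable M (\<lambda>\<omega>. free_response i t \<omega> * noise_response j t \<omega>)" for i j
    proof -
      have "integrable M (\<lambda>\<omega>. \<Sum>k<N. lattice_kernel i k t * (x 0 \<omega> $ k * noise_response j t \<omega>))"
        using elim
        by (intro Bochner_Integration.integrable_sum integrable_mult_right initial_noise_integrable) auto
      then show ?thesis by (simp add: free_response_def sum_distrib_right mult.assoc)
    qed
    have "expectation (\<lambda>\<omega>. x t \<omega> $ i * x t \<omega> $ j) =
        expectation (\<lambda>\<omega>. free_response i t \<omega> * free_response j t \<omega> + free_response i t \<omega> * noise_response j t \<omega>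
          + free_response j t \<omega> * noise_response i t \<omega> + noise_response i t \<omega> * noise_response j t \<omega>)"
    proof (rule integral_cong_AE)
      have [measurable]: "free_response i t \<in> borel_measurable M" for i
        unfolding free_response_def [abs_def] by measurable
      show "(\<lambda>\<omega>. free_response i t \<omega> * free_response j t \<omega> + free_response i t \<omega> * noise_response j t \<omega>
          + free_response j t \<omega> * noise_response i t \<omega> + noise_response i t \<omega> * noise_response j t \<omega>)
          \<in> borel_measurable M" by measurable
      show "(\<lambda>\<omega>. x t \<omega> $ i * x t \<omega> $ j) \<in> borel_measurable M"
        using state_measurable [OF i elim] state_measurable [OF j elim] by measurable
      show "AE \<omega> in M. x t \<omega> $ i * x t \<omega> $ j = free_response i t \<omega> * free_response j t \<omega>
          + free_response i t \<omega> * noise_response j t \<omega> + free_response j t \<omega> * noise_response i t \<omega>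
          + noise_response i t \<omega> * noise_response j t \<omega>"
        using state_eq_response [OF elim] by eventually_elim (simp add: i j algebra_simps)
    qed
    then show ?case using ff fn noise_response_covariance(1) [OF elim] by simp
  qed
  ultimately show ?thesis by (simp add: Lim_transform_eventually)
qed

end

theorem lemma1:
  shows "(\<forall>N\<ge>1. \<forall>(M :: 'a measure) W x. leader_follower M N W x \<longrightarrow>
            (\<forall>i<N. \<forall>j<N. ((\<lambda>t. prob_space.expectation M (\<lambda>\<omega>. x t \<omega> $ i * x t \<omega> $ j))
                \<longlongrightarrow> steady_state_cov N $$ (i, j)) at_top) \<and>
            (\<forall>n\<in>{1..N}. ((\<lambda>t. prob_space.expectation M (\<lambda>\<omega>. (x t \<omega> $ (n - 1))\<^sup>2))
                \<longlongrightarrow> steady_state_var N n) at_top))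
       \<and> (\<forall>N\<ge>1. \<forall>n\<in>{1..N}.
            steady_state_var N n
              = (\<Sum>i=1..n. fact (2 * i - 2) / (2 * 2 ^ (2 * i - 2) * (fact (i - 1))\<^sup>2))
          \<and> steady_state_var N n = real n * fact (2 * n) / (2 ^ (2 * n) * fact n * fact n))
       \<and> (\<forall>N\<ge>1. normalized_total_var N
              = fact (2 * N + 1) / (3 * 2 ^ (2 * N) * fact N * fact N))
       \<and> (\<forall>n\<ge>1. \<forall>N\<ge>n. steady_state_var N n = steady_state_var n n)
       \<and> (\<lambda>n. steady_state_var n n / sqrt (real n)) \<longlonglongrightarrow> sqrt (1 / pi)
       \<and> (\<lambda>N. normalized_total_var N / sqrt (real N)) \<longlonglongrightarrow> 2 / (3 * sqrt pi)"
proof (intro conjI)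
  show "\<forall>N\<ge>1. \<forall>(M :: 'a measure) W x. leader_follower M N W x \<longrightarrow>
      (\<forall>i<N. \<forall>j<N. ((\<lambda>t. prob_space.expectation M (\<lambda>\<omega>. x t \<omega> $ i * x t \<omega> $ j))
          \<longlongrightarrow> steady_state_cov N $$ (i, j)) at_top) \<and>
      (\<forall>n\<in>{1..N}. ((\<lambda>t. prob_space.expectation M (\<lambda>\<omega>. (x t \<omega> $ (n - 1))\<^sup>2))
          \<longlongrightarrow> steady_state_var N n) at_top)"
  proof (intro allI impI conjI ballI)
    fix N :: nat and M :: "'a measure" and W x
    assume "leader_follower M N W x"
    then interpret leader_follower M N W x .
    show "((\<lambda>t. expectation (\<lambda>\<omega>. x t \<omega> $ i * x t \<omega> $ j)) \<longlongrightarrow> steady_state_cov N $$ (i, j)) at_top"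
      if "i < N" "j < N" for i j
      using that by (rule covariance_tendsto_steady_state)
    show "((\<lambda>t. expectation (\<lambda>\<omega>. (x t \<omega> $ (n - 1))\<^sup>2)) \<longlongrightarrow> steady_state_var N n) at_top"
      if "n \<in> {1..N}" for n
      using that covariance_tendsto_steady_state [of "n - 1" "n - 1"]
      by (auto simp: steady_state_var_def power2_eq_square)
  qed
next
  show "\<forall>N\<ge>1. \<forall>n\<in>{1..N}.
      steady_state_var N n
        = (\<Sum>i=1..n. fact (2 * i - 2) / (2 * 2 ^ (2 * i - 2) * (fact (i - 1))\<^sup>2))
    \<and> steady_state_var N n = real n * fact (2 * n) / (2 ^ (2 * n) * fact n * fact n)"
    by (intro allI impI ballI conjI steady_state_var_closed_forms) simp_all
  show "\<forall>N\<ge>1. normalized_total_var N = fact (2 * N + 1) / (3 * 2 ^ (2 * N) * fact N * fact N)"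
    using normalized_total_var_closed_form by blast
  show "\<forall>n\<ge>1. \<forall>N\<ge>n. steady_state_var N n = steady_state_var n n"
    by (intro allI impI) (simp add: steady_state_var_eq)
qed (rule steady_state_var_asymptotics normalized_total_var_asymptotics)+

end
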